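(* There exists $c>0$ such that the mixing time of the Glauber dynamics with parameter $\lambda$ on the set $\Omega_{m,n}$ of triangulations of $\Lambda^0_{m,n}$, in the absence of constraints, satisfies $$T_{\mathrm{mix}}\ge c\,mn(m+n)$$ for all integers $m,n\ge1$ and all $\lambda>0$.
   Context: Triangulations. $\Lambda^0_{m,n}=\{0,1,\dots,m\}\times\{0,1,\dots,n\}\subset\mathbb{Z}^2$. An edge is a straight segment joining two points of $\Lambda^0_{m,n}$ and passing through no other integer point. Two edges cross if they are distinct and meet at a point that is not a common endpoint. A (full) triangulation of $\Lambda^0_{m,n}$ is a maximal set of pairwise noncrossing edges; $\Omega_{m,n}$ is the set of all of them. In every triangulation the set of midpoints of the edges is exactly $\Lambda=\Lambda_{m,n}=\bigl(\{0,\frac12,1,\dots,m\}\times\{0,\frac12,1,\dots,n\}\bigr)\setminus\Lambda^0_{m,n}$, each midpoint occurring once; so a triangulation is written $\sigma=\{\sigma_x\}_{x\in\Lambda}$, where $\sigma_x$ is the edge with midpoint $x$. Gibbs distribution. $|\sigma_x|$ is the $\ell_1$ length of $\sigma_x$, $|\sigma|=\sum_x|\sigma_x|$, and $\mu(\sigma)=\lambda^{|\sigma|}/\sum_{\tau\in\Omega_{m,n}}\lambda^{|\tau|}$. Glauber dynamics. An edge $\sigma_x$ lying in two triangles of $\sigma$ is flippable if the two triangles form a convex quadrilateral (then necessarily a parallelogram); the flip replaces $\sigma_x$ by the other diagonal $\sigma_x'$ (also with midpoint $x$). One step from $\sigma$: pick $x\in\Lambda$ uniformly at random; if $\sigma_x$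 is flippable to $\sigma'_x$, flip it with probability $\lambda^{|\sigma'_x|}/(\lambda^{|\sigma'_x|}+\lambda^{|\sigma_x|})$; otherwise do nothing. Mixing time. $T_{\mathrm{mix}}=\inf\{t\in\mathbb{N}:\max_{\sigma}\|p^t(\sigma,\cdot)-\mu\|\le 1/4\}$, where $p^t(\sigma,\cdot)$ is the law after $t$ steps started at $\sigma$ and $\|\cdot\|$ is total variation distance. *)

theory Defs
  imports "HOL-Probability.Probability" "HOL-Library.Extended_Nat"
begin

section \<open>Lattice triangulations\<close>

type_synonym point = "real \<times> real"

text \<open>Edges are represented by the closed segments themselves, as subsets of the plane.\<close>

type_synonym edge = "point set"

type_synonym triangulation = "edge set"

definition lattice_points :: "nat \<Rightarrow> nat \<Rightarrow> point set" where
  "lattice_points m n = (\<lambda>(i, j). (real i, real j)) ` ({0..m} \<times> {0..n})"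

definition edges :: "nat \<Rightarrow> nat \<Rightarrow> edge set" where
  "edges m n = {closed_segment a b | a b.
     a \<in> lattice_points m n \<and> b \<in> lattice_points m n \<and> a \<noteq> b \<and>
     closed_segment a b \<inter> (\<int> \<times> \<int>) = {a, b}}"

text \<open>The endpoints of a segment are its extreme points.\<close>

definition crosses :: "edge \<Rightarrow> edge \<Rightarrow> bool" where
  "crosses e f \<longleftrightarrow> e \<noteq> f \<and>
     (\<exists>p \<in> e \<inter> f. \<not> (p extreme_point_of e \<and> p extreme_point_of f))"

definition noncrossing_set :: "nat \<Rightarrow> nat \<Rightarrow> edge set \<Rightarrow> bool" where
  "noncrossing_set m n \<sigma> \<longleftrightarrow> \<sigma> \<subseteq> edges m n \<and> pairwise (\<lambda>e f. \<not> crosses e f) \<sigma>"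

definition triangulations :: "nat \<Rightarrow> nat \<Rightarrow> triangulation set" where
  "triangulations m n = {\<sigma>. noncrossing_set m n \<sigma> \<and>
     (\<forall>\<tau>. noncrossing_set m n \<tau> \<longrightarrow> \<sigma> \<subseteq> \<tau> \<longrightarrow> \<tau> = \<sigma>)}"

definition midpoints :: "nat \<Rightarrow> nat \<Rightarrow> point set" where
  "midpoints m n =
     (\<lambda>(i, j). (real i / 2, real j / 2)) ` ({0..2 * m} \<times> {0..2 * n}) - lattice_points m n"

text \<open>In a triangulation, every point of \<open>midpoints m n\<close> is the midpoint of exactly one edge.\<close>

definition edge_at :: "triangulation \<Rightarrow> point \<Rightarrow> edge" where
  "edge_at \<sigma> x = (THE e. e \<in> \<sigma> \<and> (\<exists>a b. e = closed_segment a b \<and> midpoint a b = x))"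

definition edge_length :: "edge \<Rightarrow> real" where
  "edge_length e = (THE l. \<exists>a b. e = closed_segment a b \<and>
     l = \<bar>fst a - fst b\<bar> + \<bar>snd a - snd b\<bar>)"

definition total_length :: "nat \<Rightarrow> nat \<Rightarrow> triangulation \<Rightarrow> real" where
  "total_length m n \<sigma> = (\<Sum>x \<in> midpoints m n. edge_length (edge_at \<sigma> x))"

lemma edge_length_closed_segment:
  "edge_length (closed_segment a b) = \<bar>fst a - fst b\<bar> + \<bar>snd a - snd b\<bar>"
  unfolding edge_length_def
proof (rule the_equality)
  show "\<exists>a' b'. closed_segment a b = closed_segment a' b' \<and>
    \<bar>fst a - fst b\<bar> + \<bar>snd a - snd b\<bar> = \<bar>fst a' - fst b'\<bar> + \<bar>snd a' - snd b'\<bar>"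
    by blast
qed (auto simp: closed_segment_eq doubleton_eq_iff abs_minus_commute)

lemma finite_edges: "finite (edges m n)"
proof -
  have "edges m n \<subseteq> (\<lambda>(a, b). closed_segment a b) ` (lattice_points m n \<times> lattice_points m n)"
    unfolding edges_def by auto
  then show ?thesis
    by (rule finite_subset) (auto simp: lattice_points_def)
qed

lemma finite_triangulations: "finite (triangulations m n)"
  using finite_edges [of m n]
  by (rule finite_subset [OF _ finite_Pow_iff [THEN iffD2], rotated])
     (auto simp: triangulations_def noncrossing_set_def)

lemma triangulations_nonempty: "triangulations m n \<noteq> {}"
proof -
  have "finite {\<sigma>. noncrossing_set m n \<sigma>}"
    using finite_edges [of m n]
    by (rule finite_subset [OF _ finite_Pow_iff [THEN iffD2], rotated])
       (auto simp: noncrossing_set_def)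
  moreover have "{\<sigma>. noncrossing_set m n \<sigma>} \<noteq> {}"
    by (auto simp: noncrossing_set_def intro!: exI [of _ "{}"])
  ultimately obtain \<sigma> where "noncrossing_set m n \<sigma>"
    "\<And>\<tau>. noncrossing_set m n \<tau> \<Longrightarrow> \<sigma> \<subseteq> \<tau> \<Longrightarrow> \<sigma> = \<tau>"
    using finite_has_maximal [of "{\<sigma>. noncrossing_set m n \<sigma>}"] by auto
  then show ?thesis
    by (auto simp: triangulations_def)
qed


section \<open>Gibbs distribution\<close>

definition gibbs :: "nat \<Rightarrow> nat \<Rightarrow> real \<Rightarrow> triangulation pmf" where
  "gibbs m n lam = embed_pmf (\<lambda>\<sigma>. if \<sigma> \<in> triangulations m n
     then lam powr total_length m n \<sigma> / (\<Sum>\<tau> \<in> triangulations m n. lam powr total_length m n \<tau>)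
     else 0)"

lemma pmf_gibbs:
  assumes "lam > 0"
  shows "pmf (gibbs m n lam) \<sigma> = (if \<sigma> \<in> triangulations m n
     then lam powr total_length m n \<sigma> / (\<Sum>\<tau> \<in> triangulations m n. lam powr total_length m n \<tau>)
     else 0)"
proof -
  let ?T = "triangulations m n" and ?w = "\<lambda>\<sigma>. lam powr total_length m n \<sigma>"
  let ?f = "\<lambda>\<sigma>. if \<sigma> \<in> ?T then ?w \<sigma> / sum ?w ?T else 0"
  have pos: "sum ?w ?T > 0"
    using assms finite_triangulations triangulations_nonempty by (intro sum_pos) auto
  have nonneg: "\<And>\<sigma>. 0 \<le> ?f \<sigma>"
    using pos by (auto intro!: divide_nonneg_nonneg simp: less_imp_le)
  have "(\<integral>\<^sup>+\<sigma>. ennreal (?f \<sigma>) \<partial>count_space UNIV) = (\<integral>\<^sup>+\<sigma>. ennreal (?f \<sigma>) \<partial>count_space ?T)"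
    by (rule nn_integral_count_space_eq) auto
  also have "\<dots> = (\<Sum>\<sigma>\<in>?T. ennreal (?f \<sigma>))"
    by (rule nn_integral_count_space_finite) (rule finite_triangulations)
  also have "\<dots> = ennreal (\<Sum>\<sigma>\<in>?T. ?f \<sigma>)"
    by (rule sum_ennreal) (rule nonneg)
  also have "(\<Sum>\<sigma>\<in>?T. ?f \<sigma>) = 1"
    using pos by (simp add: sum_divide_distrib [symmetric])
  finally show ?thesis
    unfolding gibbs_def using nonneg by (subst pmf_embed_pmf) auto
qed


section \<open>Glauber dynamics\<close>

text \<open>\<open>is_triangle \<sigma> a b c\<close>: the points span a face of \<open>\<sigma>\<close>. A closed triangle whose sides belong to
  \<open>\<sigma>\<close> need not be a face, hence the condition on the interior.\<close>

definition is_triangle :: "triangulation \<Rightarrow> point \<Rightarrow> point \<Rightarrow> point \<Rightarrow> bool" where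
  "is_triangle \<sigma> a b c \<longleftrightarrow> \<not> collinear {a, b, c} \<and>
     {closed_segment a b, closed_segment b c, closed_segment a c} \<subseteq> \<sigma> \<and>
     interior (convex hull {a, b, c}) \<inter> \<Union>\<sigma> = {}"

text \<open>\<open>flips_to \<sigma> e e'\<close>: the edge \<open>e\<close> lies in two triangles of \<open>\<sigma>\<close> that form a convex quadrilateral,
  and \<open>e'\<close> is its other diagonal. The extreme-point condition excludes the case where the convex
  union of the two triangles is again a triangle.\<close>

definition flips_to :: "triangulation \<Rightarrow> edge \<Rightarrow> edge \<Rightarrow> bool" where
  "flips_to \<sigma> e e' \<longleftrightarrow> (\<exists>a b c d. e = closed_segment a b \<and> e' = closed_segment c d \<and> c \<noteq> d \<and>
     is_triangle \<sigma> a b c \<and> is_triangle \<sigma> a b d \<and>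
     (let Q = convex hull {a, b, c} \<union> convex hull {a, b, d}
      in convex Q \<and> {p. p extreme_point_of Q} = {a, b, c, d}))"

definition flippable :: "triangulation \<Rightarrow> edge \<Rightarrow> bool" where
  "flippable \<sigma> e \<longleftrightarrow> (\<exists>e'. flips_to \<sigma> e e')"

text \<open>An edge lies in at most two triangles, so the choice below is unique for a flippable edge.\<close>

definition flipped :: "triangulation \<Rightarrow> edge \<Rightarrow> edge" where
  "flipped \<sigma> e = (SOME e'. flips_to \<sigma> e e')"

definition glauber_step :: "nat \<Rightarrow> nat \<Rightarrow> real \<Rightarrow> triangulation \<Rightarrow> triangulation pmf" where
  "glauber_step m n lam \<sigma> = bind_pmf (pmf_of_set (midpoints m n)) (\<lambda>x.
     let e = edge_at \<sigma> x; e' = flipped \<sigma> e in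
     if flippable \<sigma> e
     then map_pmf (\<lambda>flip. if flip then insert e' (\<sigma> - {e}) else \<sigma>)
       (bernoulli_pmf (lam powr edge_length e' / (lam powr edge_length e' + lam powr edge_length e)))
     else return_pmf \<sigma>)"

definition glauber_law :: "nat \<Rightarrow> nat \<Rightarrow> real \<Rightarrow> nat \<Rightarrow> triangulation \<Rightarrow> triangulation pmf" where
  "glauber_law m n lam t \<sigma> = ((\<lambda>q. bind_pmf q (glauber_step m n lam)) ^^ t) (return_pmf \<sigma>)"


section \<open>Mixing time\<close>

definition tv_dist :: "'a pmf \<Rightarrow> 'a pmf \<Rightarrow> real" where
  "tv_dist p q = (SUP A. \<bar>measure_pmf.prob p A - measure_pmf.prob q A\<bar>)"

text \<open>The infimum is taken in \<open>enat\<close>, so that the infimum of the empty set is infinite.\<close>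

definition mixing_time :: "nat \<Rightarrow> nat \<Rightarrow> real \<Rightarrow> enat" where
  "mixing_time m n lam = Inf {enat t | t.
     (MAX \<sigma> \<in> triangulations m n. tv_dist (glauber_law m n lam t \<sigma>) (gibbs m n lam)) \<le> 1 / 4}"

end

theory Submission
  imports Defs
begin

text \<open>
  The bound comes from the diameter of the flip graph and does not see \<open>lam\<close>. If the laws started
  at \<open>\<sigma>\<close> and at \<open>\<tau>\<close> are both within \<open>1/4\<close> of a common distribution after \<open>t\<close> steps, they cannot
  have disjoint supports, so \<open>\<sigma>\<close> and \<open>\<tau>\<close> can be joined by \<open>2 t\<close> flips. It remains to find two
  triangulations at flip distance of order \<open>m n (m + n)\<close>.

  Distances are bounded below by a potential, \<open>slope_sum\<close>: the sum of the slopes of all edges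
  whose horizontal extent is odd. A flip exchanges the diagonals of a parallelogram of area 1. The
  two diagonals \<open>(p, q)\<close>, \<open>(p', q')\<close> agree modulo 2 and have determinant \<open>\<plusminus>2\<close>, so if \<open>p\<close> is odd, the
  slopes differ by \<open>2 / \<bar>p p'\<bar> \<le> 2\<close> (\<open>odd_slope_parallelogram_diagonals\<close>). Restricting to odd extents
  matters: a flip can turn an edge of extent 2 with arbitrary slope into a vertical one.
  Cutting the rectangle into vertical strips of width 1 and making the edges of every
  strip as steep as possible, upwards or downwards, yields two triangulations whose potentials
  differ by \<open>2 m n\<^sup>2\<close>, hence \<open>t \<ge> m n\<^sup>2 / 2\<close> (\<open>slope_sum_gap\<close>, \<open>mixing_time_ge\<close>). Exchanging the
  coordinates gives \<open>t \<ge> n m\<^sup>2 / 2\<close>, and the larger of the two bounds is at least their mean.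

  The parallelogram has area 1 because a face contains no lattice point besides its vertices. The
  reason is that the edges cover all lattice points. This property, called \<open>spanning\<close> here, holds
  for the two initial triangulations and is preserved by flips (\<open>flip_cases\<close>); it is the invariant
  along which the dynamics is followed.
\<close>

section \<open>Empty lattice triangles\<close>

definition det2 :: "point \<Rightarrow> point \<Rightarrow> real" where
  "det2 u v = fst u * snd v - snd u * fst v"

lemma int_point_cases:
  assumes "p \<in> \<int> \<times> (\<int> :: real set)"
  obtains x y :: int where "p = (real_of_int x, real_of_int y)"
  using assms by (auto elim!: Ints_cases)

text \<open>If \<open>g\<close> divides both coordinates of \<open>B - A\<close>, then \<open>A + (B - A) / g\<close> is a lattice point of the
  segment.\<close>

lemma coprime_edge_vector:
  fixes p q x y :: int
  defines "A \<equiv> (real_of_int p, real_of_int q)" and "B \<equiv> (real_of_int x, real_of_int y)"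
  assumes "A \<noteq> B" and prim: "closed_segment A B \<inter> (\<int> \<times> \<int>) = {A, B}"
  shows "coprime (x - p) (y - q)"
proof (rule ccontr)
  define g where "g = gcd (x - p) (y - q)"
  assume "\<not> coprime (x - p) (y - q)"
  then have "g \<noteq> 1" by (simp add: g_def coprime_iff_gcd_eq_1)
  moreover have "g \<noteq> 0" using \<open>A \<noteq> B\<close> by (auto simp: g_def A_def B_def)
  moreover have "g \<ge> 0" by (simp add: g_def)
  ultimately have g: "g \<ge> 2" by linarith
  obtain u v where u: "x - p = g * u" and v: "y - q = g * v"
    by (metis g_def gcd_dvd1 gcd_dvd2 dvdE)
  let ?P = "(real_of_int (p + u), real_of_int (q + v))"
  have "real_of_int (x - p) = real_of_int g * real_of_int u"
    "real_of_int (y - q) = real_of_int g * real_of_int v"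
    unfolding u v by simp_all
  then have "A + (1 / real_of_int g) *\<^sub>R (B - A) = ?P"
    using g by (simp add: A_def B_def)
  then have "?P = (1 - 1 / real_of_int g) *\<^sub>R A + (1 / real_of_int g) *\<^sub>R B"
    by (simp add: algebra_simps)
  then have "?P \<in> closed_segment A B"
    using g unfolding closed_segment_def by (intro CollectI exI [of _ "1 / real_of_int g"]) auto
  then have "?P \<in> {A, B}"
    unfolding prim [symmetric] by simp
  then have "?P = A \<or> ?P = B"
    by simp
  then have "(u = 0 \<and> v = 0) \<or> (u = x - p \<and> v = y - q)"
    unfolding A_def B_def prod.inject of_int_eq_iff by linarith
  then have "u = 0 \<and> v = 0"
    using g unfolding u v by auto
  then have "x = p" "y = q"
    using u v by simp_all
  then show False
    using \<open>A \<noteq> B\<close> by (simp add: A_def B_def)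
qed

text \<open>For \<open>u = (u1, u2)\<close> and \<open>v = (v1, v2)\<close> the point \<open>(r u + v) / h\<close> is a lattice point with
  \<open>det2 u\<close> equal to 1. These points lie on a line parallel to \<open>u\<close> and are spaced by \<open>u\<close>, because
  \<open>u\<close> extends to a lattice basis with a vector \<open>(x, y)\<close>; so some \<open>r\<close> lies in \<open>{0..<h}\<close>.\<close>

lemma lattice_line_at_unit_height:
  fixes u1 u2 v1 v2 :: int
  defines "h \<equiv> u1 * v2 - u2 * v1"
  assumes "coprime u1 u2" "h > 0"
  obtains r where "0 \<le> r" "r < h" "h dvd r * u1 + v1" "h dvd r * u2 + v2"
proof -
  obtain x y where xy: "u1 * y - u2 * x = 1"
  proof -
    obtain y x where "y * u1 + x * u2 = 1"
      using bezout_int [of u1 u2] \<open>coprime u1 u2\<close> by (auto simp: coprime_iff_gcd_eq_1)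
    then show thesis by (intro that [of y "- x"]) (simp add: algebra_simps)
  qed
  define \<alpha> where "\<alpha> = v1 * y - v2 * x"
  define r where "r = (- \<alpha>) mod h"
  have v1: "v1 = \<alpha> * u1 + h * x"
  proof -
    have "\<alpha> * u1 + h * x = v1 * (u1 * y - u2 * x)" by (simp add: \<alpha>_def h_def algebra_simps)
    then show ?thesis by (simp add: xy)
  qed
  have v2: "v2 = \<alpha> * u2 + h * y"
  proof -
    have "\<alpha> * u2 + h * y = v2 * (u1 * y - u2 * x)" by (simp add: \<alpha>_def h_def algebra_simps)
    then show ?thesis by (simp add: xy)
  qed
  have "h dvd r + \<alpha>"
    using dvd_minus_mod [of h "- \<alpha>"] dvd_minus_iff [of h "- \<alpha> - r"]
    by (simp add: r_def)
  then have "h dvd (r + \<alpha>) * u1 + h * x" "h dvd (r + \<alpha>) * u2 + h * y"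
    by auto
  then have "h dvd r * u1 + v1" "h dvd r * u2 + v2"
    by (simp_all add: v1 v2 algebra_simps)
  moreover have "0 \<le> r" "r < h"
    using \<open>h > 0\<close> by (simp_all add: r_def)
  ultimately show thesis
    using that by blast
qed

lemma DIM_point: "DIM(point) = 2"
  by simp

text \<open>Let \<open>h\<close> be the determinant. The line at height \<open>1/h\<close> of the triangle over its base \<open>a b\<close> meets
  the triangle in the points \<open>a + (r (b - a) + (c - a)) / h\<close> with \<open>0 \<le> r \<le> h - 1\<close>, and one with integral
  \<open>r\<close> is a lattice point. For \<open>h \<ge> 2\<close> it is not a vertex, so it lies in the interior or inside
  one of the two other sides.\<close>

lemma empty_lattice_triangle_det_pos:
  assumes "a \<in> \<int> \<times> \<int>" "b \<in> \<int> \<times> \<int>" "c \<in> \<int> \<times> (\<int> :: real set)"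
    and nc: "\<not> collinear {a, b, c}"
    and ab: "closed_segment a b \<inter> (\<int> \<times> \<int>) = {a, b}"
    and bc: "closed_segment b c \<inter> (\<int> \<times> \<int>) = {b, c}"
    and ac: "closed_segment a c \<inter> (\<int> \<times> \<int>) = {a, c}"
    and int: "interior (convex hull {a, b, c}) \<inter> (\<int> \<times> \<int>) = {}"
    and pos: "det2 (b - a) (c - a) > 0"
  shows "det2 (b - a) (c - a) = 1"
proof (rule ccontr)
  obtain a1 a2 b1 b2 c1 c2 :: int where
    a: "a = (real_of_int a1, real_of_int a2)" and b: "b = (real_of_int b1, real_of_int b2)"
    and c: "c = (real_of_int c1, real_of_int c2)"
    using assms(1-3) by (elim int_point_cases)
  define h where "h = (b1 - a1) * (c2 - a2) - (b2 - a2) * (c1 - a1)"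
  have det: "det2 (b - a) (c - a) = real_of_int h"
    by (simp add: det2_def a b c h_def)
  assume "det2 (b - a) (c - a) \<noteq> 1"
  with pos have h: "h \<ge> 2" by (simp add: det)
  have "a \<noteq> b" using nc by auto
  then have "coprime (b1 - a1) (b2 - a2)"
    using coprime_edge_vector ab a b by blast
  then obtain r where r: "0 \<le> r" "r < h" "h dvd r * (b1 - a1) + (c1 - a1)"
    "h dvd r * (b2 - a2) + (c2 - a2)"
    using lattice_line_at_unit_height [of "b1 - a1" "b2 - a2" "c2 - a2" "c1 - a1"] h
    unfolding h_def [symmetric] by auto
  from r(3,4) obtain x y where x: "r * (b1 - a1) + (c1 - a1) = h * x"
    and y: "r * (b2 - a2) + (c2 - a2) = h * y"
    by (auto elim!: dvdE)
  define P where "P = (real_of_int (a1 + x), real_of_int (a2 + y))"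
  define s t where "s = real_of_int r / real_of_int h" and "t = 1 / real_of_int h"
  have st: "0 \<le> s" "0 < t" "t < 1" "s + t \<le> 1"
    using r h by (auto simp: s_def t_def field_simps)
  have P: "P = (1 - s - t) *\<^sub>R a + s *\<^sub>R b + t *\<^sub>R c"
  proof -
    have "real_of_int x = s * (b1 - a1) + t * (c1 - a1)"
      "real_of_int y = s * (b2 - a2) + t * (c2 - a2)"
      using h arg_cong [OF x, of real_of_int, symmetric] arg_cong [OF y, of real_of_int, symmetric]
      by (simp_all add: s_def t_def eq_divide_eq mult.commute flip: add_divide_distrib)
    then show ?thesis by (simp add: P_def a b c algebra_simps)
  qed
  have PZ: "P \<in> \<int> \<times> \<int>" by (simp add: P_def)
  have detP: "det2 (b - a) (P - a) = 1"
  proof -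
    have "det2 (b - a) (P - a) = t * det2 (b - a) (c - a)"
      unfolding P det2_def by (simp add: algebra_simps)
    then show ?thesis using h by (simp add: det t_def)
  qed
  have "P \<noteq> a" "P \<noteq> b" "P \<noteq> c"
    using detP h det by (auto simp: det2_def)
  consider "s = 0" | "s + t = 1" | "0 < s" "s + t < 1" using st by linarith
  then show False
  proof cases
    case 1
    then have "P \<in> closed_segment a c"
      using st P unfolding closed_segment_def by auto
    then show False using ac PZ \<open>P \<noteq> a\<close> \<open>P \<noteq> c\<close> by blast
  next
    case 2
    then have "s = 1 - t" by simp
    then have "P \<in> closed_segment b c"
      using st P unfolding closed_segment_def by auto
    then show False using bc PZ \<open>P \<noteq> b\<close> \<open>P \<noteq> c\<close> by blast
  next
    case 3
    have "0 < 1 - s - t \<and> 0 < s \<and> 0 < t \<and> (1 - s - t) + s + t = 1 \<and>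
        (1 - s - t) *\<^sub>R a + s *\<^sub>R b + t *\<^sub>R c = P"
      using 3 st P by simp
    then have "P \<in> interior (convex hull {a, b, c})"
      unfolding interior_convex_hull_3_minimal [OF nc DIM_point] by blast
    then show False using int PZ by blast
  qed
qed

lemma empty_lattice_triangle_det:
  assumes "a \<in> \<int> \<times> \<int>" "b \<in> \<int> \<times> \<int>" "c \<in> \<int> \<times> (\<int> :: real set)"
    and nc: "\<not> collinear {a, b, c}"
    and ab: "closed_segment a b \<inter> (\<int> \<times> \<int>) = {a, b}"
    and bc: "closed_segment b c \<inter> (\<int> \<times> \<int>) = {b, c}"
    and ac: "closed_segment a c \<inter> (\<int> \<times> \<int>) = {a, c}"
    and int: "interior (convex hull {a, b, c}) \<inter> (\<int> \<times> \<int>) = {}"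
  shows "\<bar>det2 (b - a) (c - a)\<bar> = 1"
proof -
  have swap: "{a, c, b} = {a, b, c}" by auto
  have anti: "det2 (c - a) (b - a) = - det2 (b - a) (c - a)" by (simp add: det2_def)
  have "det2 (b - a) (c - a) \<noteq> 0"
  proof
    assume d: "det2 (b - a) (c - a) = 0"
    obtain a1 a2 b1 b2 c1 c2 where
      abc: "a = (a1, a2)" "b = (b1, b2)" "c = (c1, c2)" by (metis surj_pair)
    have "a \<noteq> b" using nc by auto
    have "\<exists>k. c - a = k *\<^sub>R (b - a)"
    proof (cases "b1 = a1")
      case True
      with \<open>a \<noteq> b\<close> d show ?thesis
        by (intro exI [of _ "(c2 - a2) / (b2 - a2)"]) (auto simp: abc det2_def)
    next
      case False
      with d show ?thesis
        by (intro exI [of _ "(c1 - a1) / (b1 - a1)"]) (auto simp: abc det2_def field_simps)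
    qed
    then obtain k where "c - a = k *\<^sub>R (b - a)" ..
    then have "collinear {b, a, c}"
      by (subst collinear_3) (auto simp: collinear_lemma)
    then show False using nc by (simp add: insert_commute)
  qed
  then consider "det2 (b - a) (c - a) > 0" | "det2 (c - a) (b - a) > 0"
    using anti by linarith
  then show ?thesis
  proof cases
    case 1
    then show ?thesis using empty_lattice_triangle_det_pos [OF assms] by simp
  next
    case 2
    have "det2 (c - a) (b - a) = 1"
      using assms 2
      by (intro empty_lattice_triangle_det_pos)
         (auto simp: swap closed_segment_commute insert_commute)
    then show ?thesis using anti by simp
  qed
qed


section \<open>Geometry of a flip\<close>

definition lattice_edge :: "point \<Rightarrow> point \<Rightarrow> bool" where
  "lattice_edge a b \<longleftrightarrow> a \<in> \<int> \<times> \<int> \<and> b \<in> \<int> \<times> \<int> \<and> a \<noteq> b \<and> closed_segment a b \<inter> (\<int> \<times> \<int>) = {a, b}"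

lemma Ints_real_obtain_nat:
  fixes x :: real
  assumes "x \<in> \<int>" "0 \<le> x" "x \<le> real n"
  obtains k where "k \<le> n" "x = real k"
proof -
  obtain i where i: "x = of_int i" using assms(1) by (auto elim: Ints_cases)
  then have "0 \<le> i" "i \<le> int n" using assms(2,3) by auto
  then show thesis using i by (intro that [of "nat i"]) auto
qed

lemma lattice_points_eq: "lattice_points m n = (\<int> \<times> \<int>) \<inter> ({0..real m} \<times> {0..real n})"
proof
  show "lattice_points m n \<subseteq> (\<int> \<times> \<int>) \<inter> ({0..real m} \<times> {0..real n})"
    by (auto simp: lattice_points_def)
  show "(\<int> \<times> \<int>) \<inter> ({0..real m} \<times> {0..real n}) \<subseteq> lattice_points m n"
    by (auto simp: lattice_points_def image_iff elim!: Ints_real_obtain_nat)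
qed

lemma closed_segment_in_edges_iff:
  "closed_segment a b \<in> edges m n \<longleftrightarrow>
     a \<in> lattice_points m n \<and> b \<in> lattice_points m n \<and> lattice_edge a b"
proof
  assume "closed_segment a b \<in> edges m n"
  then obtain a' b' where eq: "closed_segment a b = closed_segment a' b'"
    and ab: "a' \<in> lattice_points m n" "b' \<in> lattice_points m n" "a' \<noteq> b'"
      "closed_segment a' b' \<inter> (\<int> \<times> \<int>) = {a', b'}"
    unfolding edges_def by blast
  have "{a, b} = {a', b'}" using eq by (simp add: closed_segment_eq)
  moreover from this have "closed_segment a b \<inter> (\<int> \<times> \<int>) = {a, b}"
    unfolding eq by (simp only: ab(4))
  ultimately have "a \<in> lattice_points m n" "b \<in> lattice_points m n" "a \<noteq> b"
    "closed_segment a b \<inter> (\<int> \<times> \<int>) = {a, b}"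
    using ab(1-3) unfolding doubleton_eq_iff by metis+
  then show "a \<in> lattice_points m n \<and> b \<in> lattice_points m n \<and> lattice_edge a b"
    unfolding lattice_edge_def lattice_points_eq by blast
next
  assume "a \<in> lattice_points m n \<and> b \<in> lattice_points m n \<and> lattice_edge a b"
  then show "closed_segment a b \<in> edges m n"
    unfolding edges_def lattice_edge_def by blast
qed

lemma lattice_edge_coprime:
  fixes p q x y :: int
  assumes "lattice_edge (real_of_int p, real_of_int q) (real_of_int x, real_of_int y)"
  shows "coprime (x - p) (y - q)"
  using assms unfolding lattice_edge_def by (elim conjE) (rule coprime_edge_vector)

text \<open>With a Bezout relation \<open>x p + y q = 1\<close> for the coordinates \<open>(p, q)\<close> of \<open>b - a\<close>, the multiplier of
  \<open>z = (z1, z2)\<close> is \<open>x z1 + y z2\<close>.\<close>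

lemma lattice_edge_collinear:
  assumes "lattice_edge a b" "z \<in> \<int> \<times> \<int>" "det2 (b - a) z = 0"
  obtains k :: int where "z = real_of_int k *\<^sub>R (b - a)"
proof -
  obtain a1 a2 b1 b2 z1 z2 :: int where
    a: "a = (real_of_int a1, real_of_int a2)" and b: "b = (real_of_int b1, real_of_int b2)"
    and z: "z = (real_of_int z1, real_of_int z2)"
    using assms unfolding lattice_edge_def by (elim conjE int_point_cases)
  have "coprime (b1 - a1) (b2 - a2)"
    using assms(1) unfolding a b by (rule lattice_edge_coprime)
  then obtain x y where xy: "x * (b1 - a1) + y * (b2 - a2) = 1"
    using bezout_int [of "b1 - a1" "b2 - a2"] by (auto simp: coprime_iff_gcd_eq_1)
  have "real_of_int ((b1 - a1) * z2 - (b2 - a2) * z1) = 0"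
    using assms(3) by (simp add: det2_def a b z)
  then have d: "(b1 - a1) * z2 = (b2 - a2) * z1"
    by linarith
  let ?k = "x * z1 + y * z2"
  have "?k * (b1 - a1) = z1 * (x * (b1 - a1)) + y * ((b1 - a1) * z2)" by (simp add: algebra_simps)
  also have "\<dots> = z1 * (x * (b1 - a1) + y * (b2 - a2))" unfolding d by (simp add: algebra_simps)
  finally have z1: "?k * (b1 - a1) = z1" unfolding xy by simp
  have "?k * (b2 - a2) = x * ((b2 - a2) * z1) + z2 * (y * (b2 - a2))" by (simp add: algebra_simps)
  also have "\<dots> = z2 * (x * (b1 - a1) + y * (b2 - a2))" unfolding d [symmetric] by (simp add: algebra_simps)
  finally have z2: "?k * (b2 - a2) = z2" unfolding xy by simp
  have "z = real_of_int ?k *\<^sub>R (b - a)"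
    using arg_cong [OF z1, of real_of_int] arg_cong [OF z2, of real_of_int]
    by (simp add: a b z)
  then show thesis by (rule that)
qed

text \<open>On the segment, \<open>\<lambda>p. det2 (p - c) w\<close> takes integral values at lattice points and runs from 0
  to \<open>\<plusminus>1\<close>.\<close>

lemma lattice_edge_if_unimodular:
  assumes "c \<in> \<int> \<times> \<int>" "d \<in> \<int> \<times> \<int>" "w \<in> \<int> \<times> \<int>" "\<bar>det2 (d - c) w\<bar> = 1"
  shows "lattice_edge c d"
proof -
  have "c \<noteq> d" using assms(4) by (auto simp: det2_def)
  moreover have "p = c \<or> p = d" if p: "p \<in> closed_segment c d" "p \<in> \<int> \<times> \<int>" for p
  proof -
    obtain t where t: "0 \<le> t" "t \<le> 1" "p = (1 - t) *\<^sub>R c + t *\<^sub>R d"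
      using p(1) by (auto simp: in_segment)
    have "det2 (p - c) w = t * det2 (d - c) w"
      unfolding t by (simp add: det2_def algebra_simps)
    moreover have "det2 (p - c) w \<in> \<int>"
      using assms(1,3) p(2) by (auto simp: det2_def mem_Times_iff)
    moreover have "det2 (d - c) w = 1 \<or> det2 (d - c) w = -1"
      using assms(4) by linarith
    ultimately have "t \<in> \<int>"
      by auto
    then have "t = 0 \<or> t = 1"
      using t(1,2) by (auto elim!: Ints_cases)
    then show ?thesis using t(3) by auto
  qed
  ultimately show ?thesis
    using assms(1,2) unfolding lattice_edge_def by blast
qed

text \<open>The factor \<open>z\<close> is the barycentric coordinate of \<open>p\<close> at \<open>c\<close>, the height of \<open>p\<close> over \<open>a b\<close>
  relative to that of \<open>c\<close>.\<close>

lemma det2_in_triangle: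
  assumes "p \<in> convex hull {a, b, c}"
  obtains z where "0 \<le> z" "z \<le> 1" "det2 (b - a) (p - a) = z * det2 (b - a) (c - a)"
    "z = 1 \<Longrightarrow> p = c"
proof -
  obtain x y z where xyz: "0 \<le> x" "0 \<le> y" "0 \<le> z" "x + y + z = 1"
    and p: "p = x *\<^sub>R a + y *\<^sub>R b + z *\<^sub>R c"
    using assms by (auto simp: convex_hull_3)
  have x: "x = 1 - y - z" using xyz by simp
  show thesis
  proof (rule that)
    show "det2 (b - a) (p - a) = z * det2 (b - a) (c - a)"
      unfolding p x det2_def by (simp add: algebra_simps)
    show "p = c" if "z = 1"
      using that xyz p by (auto simp: add_nonneg_eq_0_iff)
  qed (use xyz in auto)
qed

text \<open>If \<open>c\<close> and \<open>d\<close> were on the same side of \<open>a b\<close>, they would have the same height, and their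
  midpoint would be a point of maximal height in one of the triangles other than its apex. So they are on
  opposite sides, and their midpoint is \<open>a + (k / 2) (b - a)\<close> with an integer \<open>k\<close>. All values of \<open>k\<close>
  except 1 put \<open>a\<close> or \<open>b\<close> in the relative interior of a segment in \<open>Q\<close>.\<close>

lemma convex_quadrilateral_parallelogram:
  fixes a b c d :: point
  defines "Q \<equiv> convex hull {a, b, c} \<union> convex hull {a, b, d}"
  assumes edge: "lattice_edge a b" and cd: "c \<in> \<int> \<times> \<int>" "d \<in> \<int> \<times> \<int>" "c \<noteq> d"
    and c: "\<bar>det2 (b - a) (c - a)\<bar> = 1" and d: "\<bar>det2 (b - a) (d - a)\<bar> = 1"
    and conv: "convex Q" and ext: "{p. p extreme_point_of Q} = {a, b, c, d}"
  shows "c + d = a + b" "det2 (b - a) (d - a) = - det2 (b - a) (c - a)"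
proof -
  define M where "M = midpoint c d"
  have in_Q: "a \<in> Q" "b \<in> Q" "c \<in> Q" "d \<in> Q"
    using ext by (auto simp: extreme_point_of_def)
  then have "M \<in> Q"
    unfolding M_def using conv
    by (meson closed_segment_subset midpoint_in_closed_segment subsetD)
  have detM: "2 * det2 (b - a) (M - a) = det2 (b - a) (c - a) + det2 (b - a) (d - a)"
    by (simp add: M_def midpoint_def det2_def field_simps)
  have Mcd: "M \<noteq> c" "M \<noteq> d"
    using cd by (auto simp: M_def midpoint_eq_endpoint)
  show opposite: "det2 (b - a) (d - a) = - det2 (b - a) (c - a)"
  proof (rule ccontr)
    assume "\<not> ?thesis"
    with c d have same: "det2 (b - a) (d - a) = det2 (b - a) (c - a)" by (auto simp: abs_if split: if_splits)
    with detM have eq: "det2 (b - a) (M - a) = det2 (b - a) (c - a)" by simp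
    have nz: "det2 (b - a) (c - a) \<noteq> 0" using c by auto
    consider "M \<in> convex hull {a, b, c}" | "M \<in> convex hull {a, b, d}"
      using \<open>M \<in> Q\<close> by (auto simp: Q_def)
    then show False
    proof cases
      case 1
      then show False using det2_in_triangle [OF 1] eq nz Mcd by (metis mult_cancel_right1)
    next
      case 2
      then show False using det2_in_triangle [OF 2] eq same nz Mcd by (metis mult_cancel_right1)
    qed
  qed
  have a_ext: "a extreme_point_of Q" and b_ext: "b extreme_point_of Q" using ext by blast+
  have "a \<noteq> b" using edge by (simp add: lattice_edge_def)
  have det0: "det2 (b - a) (c + d - 2 *\<^sub>R a) = 0"
    using opposite by (simp add: det2_def algebra_simps)
  have "c + d - 2 *\<^sub>R a \<in> \<int> \<times> \<int>"
    using cd edge by (auto simp: lattice_edge_def mem_Times_iff)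
  then obtain k :: int where k: "c + d - 2 *\<^sub>R a = real_of_int k *\<^sub>R (b - a)"
    using lattice_edge_collinear [OF edge _ det0] by metis
  have M: "M = a + (k / 2) *\<^sub>R (b - a)"
  proof -
    have "c + d = 2 *\<^sub>R a + real_of_int k *\<^sub>R (b - a)"
      using k by (simp add: algebra_simps)
    then show ?thesis
      unfolding M_def midpoint_def by (simp add: scaleR_add_right)
  qed
  have "k = 1"
  proof (rule ccontr)
    assume "k \<noteq> 1"
    then consider "k = 0" | "k < 0" | "k = 2" | "k > 2" by linarith
    then show False
    proof cases
      case 1
      then have "a \<in> open_segment c d"
        using M cd(3) midpoint_in_open_segment [of c d] by (simp add: M_def)
      then show False using a_ext in_Q by (auto simp: extreme_point_of_def)
    next
      case 2
      \<comment> \<open>\<open>a\<close> divides the segment from \<open>M\<close> to \<open>b\<close> in the ratio \<open>-k/2 : 1\<close>.\<close>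
      define t where "t = real_of_int k / (real_of_int k - 2)"
      have t: "0 < t" "t < 1" "(1 - t) * (k / 2) + t = 0"
        using 2 by (auto simp: t_def field_simps)
      have "(1 - t) *\<^sub>R M + t *\<^sub>R b = a + ((1 - t) * (k / 2) + t) *\<^sub>R (b - a)"
        unfolding M by (simp add: algebra_simps)
      then have "a = (1 - t) *\<^sub>R M + t *\<^sub>R b"
        unfolding t(3) by simp
      moreover have "M \<noteq> b"
        using calculation t(2) \<open>a \<noteq> b\<close> by (auto simp flip: scaleR_add_left)
      ultimately have "a \<in> open_segment M b"
        using t(1,2) unfolding in_segment by blast
      then show False using a_ext in_Q \<open>M \<in> Q\<close> by (auto simp: extreme_point_of_def)
    next
      case 3
      then have "b \<in> open_segment c d"
        using M cd(3) midpoint_in_open_segment [of c d] by (simp add: M_def)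
      then show False using b_ext in_Q by (auto simp: extreme_point_of_def)
    next
      case 4
      define t where "t = 2 / real_of_int k"
      have t: "0 < t" "t < 1" "t * (k / 2) = 1"
        using 4 by (auto simp: t_def field_simps)
      have "(1 - t) *\<^sub>R a + t *\<^sub>R M = a + (t * (k / 2)) *\<^sub>R (b - a)"
        unfolding M by (simp add: algebra_simps)
      then have "b = (1 - t) *\<^sub>R a + t *\<^sub>R M"
        unfolding t(3) by simp
      moreover have "M \<noteq> a"
        using calculation \<open>a \<noteq> b\<close> by (auto simp flip: scaleR_add_left)
      ultimately have "b \<in> open_segment a M"
        using t(1,2) unfolding in_segment by blast
      then show False using b_ext in_Q \<open>M \<in> Q\<close> by (auto simp: extreme_point_of_def)
    qed
  qed
  then show "c + d = a + b"
    using k by (simp add: algebra_simps scaleR_2)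
qed

definition spanning :: "nat \<Rightarrow> nat \<Rightarrow> edge set \<Rightarrow> bool" where
  "spanning m n \<sigma> \<longleftrightarrow> \<sigma> \<subseteq> edges m n \<and> lattice_points m n \<subseteq> \<Union>\<sigma>"

text \<open>A lattice point in the interior of the face would lie on an edge of \<open>\<sigma>\<close>, which the definition of
  a face excludes.\<close>

lemma spanning_face_unimodular:
  assumes "spanning m n \<sigma>" and tri: "is_triangle \<sigma> a b c"
  shows "\<bar>det2 (b - a) (c - a)\<bar> = 1"
proof -
  have "closed_segment a b \<in> edges m n" "closed_segment b c \<in> edges m n"
    "closed_segment a c \<in> edges m n"
    using assms unfolding spanning_def is_triangle_def by blast+
  then have E: "lattice_edge a b" "lattice_edge b c" "lattice_edge a c"
    and L: "a \<in> lattice_points m n" "b \<in> lattice_points m n" "c \<in> lattice_points m n"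
    unfolding closed_segment_in_edges_iff by blast+
  have "convex hull {a, b, c} \<subseteq> {0..real m} \<times> {0..real n}"
    using L unfolding lattice_points_eq by (intro hull_minimal convex_Times convex_real_interval) auto
  then have "interior (convex hull {a, b, c}) \<inter> (\<int> \<times> \<int>) \<subseteq> lattice_points m n"
    unfolding lattice_points_eq using interior_subset [of "convex hull {a, b, c}"] by blast
  also have "\<dots> \<subseteq> \<Union>\<sigma>"
    using assms(1) by (simp add: spanning_def)
  finally have "interior (convex hull {a, b, c}) \<inter> (\<int> \<times> \<int>) \<subseteq>
      interior (convex hull {a, b, c}) \<inter> \<Union>\<sigma>"
    by simp
  also have "\<dots> = {}"
    using tri by (simp add: is_triangle_def)
  finally have "interior (convex hull {a, b, c}) \<inter> (\<int> \<times> \<int>) = {}"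
    by simp
  then show ?thesis
    using E tri unfolding lattice_edge_def is_triangle_def
    by (elim conjE) (rule empty_lattice_triangle_det)
qed

text \<open>The new edge passes through the interior of a face, hence is not in \<open>\<sigma>\<close>. The endpoints of the
  removed edge stay covered by the sides of the parallelogram.\<close>

lemma flip_cases:
  assumes "spanning m n \<sigma>" and flip: "flips_to \<sigma> e e'"
  obtains a b c d where
    "e = closed_segment a b" "e' = closed_segment c d"
    "lattice_edge a b" "lattice_edge c d" "\<bar>det2 (b - a) (d - c)\<bar> = 2" "c + d = a + b"
    "e \<in> \<sigma>" "e' \<notin> \<sigma>" "spanning m n (insert e' (\<sigma> - {e}))"
proof -
  obtain a b c d where e: "e = closed_segment a b" and e': "e' = closed_segment c d" and "c \<noteq> d"
    and T: "is_triangle \<sigma> a b c" "is_triangle \<sigma> a b d"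
    and Q: "convex (convex hull {a, b, c} \<union> convex hull {a, b, d})"
      "{p. p extreme_point_of convex hull {a, b, c} \<union> convex hull {a, b, d}} = {a, b, c, d}"
    using flip unfolding flips_to_def Let_def by blast
  have sub: "\<sigma> \<subseteq> edges m n" using assms(1) by (simp add: spanning_def)
  have nc: "\<not> collinear {a, b, c}" using T(1) by (simp add: is_triangle_def)
  have \<sigma>: "closed_segment a b \<in> \<sigma>" "closed_segment a c \<in> \<sigma>" "closed_segment b c \<in> \<sigma>"
    "closed_segment a d \<in> \<sigma>"
    using T unfolding is_triangle_def by blast+
  then have L: "a \<in> lattice_points m n" "b \<in> lattice_points m n" "c \<in> lattice_points m n"
    "d \<in> lattice_points m n" and ab: "lattice_edge a b"
    using sub closed_segment_in_edges_iff by blast+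
  then have Z: "a \<in> \<int> \<times> \<int>" "b \<in> \<int> \<times> \<int>" "c \<in> \<int> \<times> \<int>" "d \<in> \<int> \<times> \<int>"
    unfolding lattice_points_eq by blast+
  note det = spanning_face_unimodular [OF assms(1) T(1)] spanning_face_unimodular [OF assms(1) T(2)]
  note par = convex_quadrilateral_parallelogram [OF ab Z(3,4) \<open>c \<noteq> d\<close> det Q]
  have "det2 (b - a) (d - c) = det2 (b - a) (d - a) - det2 (b - a) (c - a)"
    by (simp add: det2_def algebra_simps)
  then have det_diag: "\<bar>det2 (b - a) (d - c)\<bar> = 2"
    using det par(2) by auto
  have d: "d = a + b - c" using par(1) by (simp add: algebra_simps)
  have "det2 (d - c) (c - a) = det2 (b - a) (c - a)"
    unfolding d by (simp add: det2_def algebra_simps)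
  moreover have "c - a \<in> \<int> \<times> \<int>" using Z by (auto simp: mem_Times_iff)
  ultimately have cd: "lattice_edge c d"
    using Z det by (intro lattice_edge_if_unimodular [of _ _ "c - a"]) auto
  have "(1/4) *\<^sub>R a + (1/4) *\<^sub>R b + (1/2) *\<^sub>R c \<in> interior (convex hull {a, b, c})"
    unfolding interior_convex_hull_3_minimal [OF nc DIM_point]
    by (intro CollectI exI [of _ "1/4"] exI [of _ "1/2"]) simp
  moreover have "(1/4) *\<^sub>R a + (1/4) *\<^sub>R b + (1/2) *\<^sub>R c \<in> closed_segment c d"
  proof -
    have "(1/4) *\<^sub>R a + (1/4) *\<^sub>R b + (1/2) *\<^sub>R c = (1 - 1/4) *\<^sub>R c + (1/4) *\<^sub>R d"
      unfolding d by (simp add: scaleR_add_right scaleR_diff_right flip: scaleR_diff_left scaleR_add_left)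
    then show ?thesis unfolding in_segment by (intro exI [of _ "1/4"]) simp
  qed
  ultimately have new: "e' \<notin> \<sigma>"
    using T(1) unfolding is_triangle_def e' by blast
  have "\<Union>\<sigma> \<inter> lattice_points m n \<subseteq> \<Union>(insert e' (\<sigma> - {e}))"
  proof
    fix p assume p: "p \<in> \<Union>\<sigma> \<inter> lattice_points m n"
    then obtain f where f: "f \<in> \<sigma>" "p \<in> f" by blast
    have "closed_segment a c \<noteq> e" "closed_segment b c \<noteq> e"
      using nc by (auto simp: e closed_segment_eq doubleton_eq_iff insert_commute)
    moreover have "p = a \<or> p = b" if "f = e"
      using that f p ab unfolding e lattice_edge_def lattice_points_eq by blast
    ultimately show "p \<in> \<Union>(insert e' (\<sigma> - {e}))"
      using f \<sigma> by (cases "f = e") auto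
  qed
  moreover have "e' \<in> edges m n"
    unfolding e' closed_segment_in_edges_iff using L cd by simp
  ultimately have "spanning m n (insert e' (\<sigma> - {e}))"
    using assms(1) unfolding spanning_def by blast
  then show thesis
    using that e e' ab cd det_diag par(1) \<sigma>(1) new by blast
qed


section \<open>The slope sum\<close>

text \<open>The expression for \<open>s\<close> is symmetric in \<open>a\<close> and \<open>b\<close> for arbitrary real endpoints, which makes
  the value independent of the orientation of the segment; a test such as \<open>odd \<lfloor>fst b - fst a\<rfloor>\<close> would be
  symmetric for integral extents only.\<close>

definition odd_slope :: "edge \<Rightarrow> real" where
  "odd_slope e = (THE s. \<exists>a b. e = closed_segment a b \<and>
     s = (if \<exists>k::int. fst b - fst a = 2 * of_int k + 1 then (snd b - snd a) / (fst b - fst a) else 0))"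

lemma odd_slope_closed_segment:
  "odd_slope (closed_segment a b) =
     (if \<exists>k::int. fst b - fst a = 2 * of_int k + 1 then (snd b - snd a) / (fst b - fst a) else 0)"
proof -
  let ?s = "\<lambda>a b :: point.
    if \<exists>k::int. fst b - fst a = 2 * of_int k + 1 then (snd b - snd a) / (fst b - fst a) else 0"
  have odd_comm: "\<exists>k::int. fst b - fst a = 2 * of_int k + 1" if "\<exists>k::int. fst a - fst b = 2 * of_int k + 1"
    for a b :: point
  proof -
    from that obtain k :: int where "fst a - fst b = 2 * of_int k + 1" ..
    then show ?thesis by (intro exI [of _ "- k - 1"]) simp
  qed
  have div: "(snd a - snd b) / (fst a - fst b) = (snd b - snd a) / (fst b - fst a)" for a b :: point
    by (metis minus_diff_eq minus_divide_divide)
  have comm: "?s a b = ?s b a" for a b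
    using odd_comm [of a b] odd_comm [of b a] div [of a b] by auto
  show ?thesis
    unfolding odd_slope_def
  proof (rule the_equality)
    fix s assume "\<exists>a' b'. closed_segment a b = closed_segment a' b' \<and> s = ?s a' b'"
    then obtain a' b' where "closed_segment a b = closed_segment a' b'" "s = ?s a' b'" by blast
    then show "s = ?s a b"
      using comm [of a b] by (auto simp only: closed_segment_eq doubleton_eq_iff)
  qed blast
qed

definition slope_sum :: "edge set \<Rightarrow> real" where
  "slope_sum \<sigma> = (\<Sum>e\<in>\<sigma>. odd_slope e)"

text \<open>\<open>c + d = a + b\<close> makes the horizontal extents \<open>p\<close>, \<open>p'\<close> congruent modulo 2, and
  \<open>q' / p' - q / p = det2 (b - a) (d - c) / (p p')\<close>, where \<open>p p'\<close> is a nonzero integer if \<open>p\<close> is odd.\<close>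

lemma odd_slope_parallelogram_diagonals:
  assumes "lattice_edge a b" "lattice_edge c d" "c + d = a + b" "\<bar>det2 (b - a) (d - c)\<bar> = 2"
  shows "\<bar>odd_slope (closed_segment c d) - odd_slope (closed_segment a b)\<bar> \<le> 2"
proof -
  obtain a1 a2 b1 b2 c1 c2 d1 d2 :: int where
    a: "a = (real_of_int a1, real_of_int a2)" and b: "b = (real_of_int b1, real_of_int b2)" and
    c: "c = (real_of_int c1, real_of_int c2)" and d: "d = (real_of_int d1, real_of_int d2)"
    using assms(1,2) unfolding lattice_edge_def by (elim conjE int_point_cases)
  define p q p' q' where "p = b1 - a1" and "q = b2 - a2" and "p' = d1 - c1" and "q' = d2 - c2"
  have odd_iff: "(\<exists>k::int. real_of_int x = 2 * of_int k + 1) \<longleftrightarrow> odd x" for x :: int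
  proof -
    have "real_of_int x = 2 * of_int k + 1 \<longleftrightarrow> x = 2 * k + 1" for k by linarith
    then show ?thesis by (auto elim: oddE)
  qed
  have ab: "odd_slope (closed_segment a b) = (if odd p then real_of_int q / real_of_int p else 0)"
    using odd_iff [of p] by (simp add: odd_slope_closed_segment a b p_def q_def)
  have cd: "odd_slope (closed_segment c d) = (if odd p' then real_of_int q' / real_of_int p' else 0)"
    using odd_iff [of p'] by (simp add: odd_slope_closed_segment c d p'_def q'_def)
  have "real_of_int (c1 + d1) = real_of_int (a1 + b1)"
    using assms(3) by (simp add: a b c d)
  then have "p' = p + 2 * (a1 - c1)"
    unfolding p_def p'_def of_int_eq_iff by presburger
  then have parity: "odd p' \<longleftrightarrow> odd p" by simp
  show ?thesis
  proof (cases "odd p")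
    case False
    then show ?thesis by (simp add: ab cd parity)
  next
    case True
    have det: "\<bar>real_of_int p * real_of_int q' - real_of_int q * real_of_int p'\<bar> = 2"
      using assms(4) by (simp add: det2_def a b c d p_def q_def p'_def q'_def)
    have nz: "p \<noteq> 0" "p' \<noteq> 0" using True parity by auto
    then have "\<bar>p\<bar> * \<bar>p'\<bar> \<ge> 1 * 1"
      by (intro mult_mono) auto
    then have ge: "\<bar>real_of_int p * real_of_int p'\<bar> \<ge> 1"
      unfolding abs_mult by (metis mult_1 of_int_1_le_iff of_int_abs of_int_mult)
    have "real_of_int q' / real_of_int p' - real_of_int q / real_of_int p =
        (real_of_int p * real_of_int q' - real_of_int q * real_of_int p') / (real_of_int p * real_of_int p')"
      using nz by (simp add: field_simps)
    then have "\<bar>real_of_int q' / real_of_int p' - real_of_int q / real_of_int p\<bar> =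
        2 / \<bar>real_of_int p * real_of_int p'\<bar>"
      by (simp only: abs_divide det)
    also have "\<dots> \<le> 2"
      using ge by (simp add: divide_le_eq)
    finally show ?thesis
      using True by (simp add: ab cd parity)
  qed
qed

lemma spanning_finite: "spanning m n \<sigma> \<Longrightarrow> finite \<sigma>"
  using finite_edges finite_subset unfolding spanning_def by blast

lemma slope_sum_flip:
  assumes "spanning m n \<sigma>" "flips_to \<sigma> e e'"
  shows "\<bar>slope_sum (insert e' (\<sigma> - {e})) - slope_sum \<sigma>\<bar> \<le> 2"
proof -
  from assms obtain a b c d where abcd: "e = closed_segment a b" "e' = closed_segment c d"
    "lattice_edge a b" "lattice_edge c d" "\<bar>det2 (b - a) (d - c)\<bar> = 2" "c + d = a + b"
    "e \<in> \<sigma>" "e' \<notin> \<sigma>"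
    by (rule flip_cases)
  have "slope_sum (insert e' (\<sigma> - {e})) - slope_sum \<sigma> = odd_slope e' - odd_slope e"
    using abcd(7,8) spanning_finite [OF assms(1)] by (simp add: slope_sum_def sum_diff1)
  then show ?thesis
    using odd_slope_parallelogram_diagonals abcd by simp
qed


section \<open>Triangulations made of unit strips\<close>

text \<open>A pair \<open>(j, k)\<close> stands for the edge from height \<open>j\<close> on the left to height \<open>k\<close> on the right side of
  a strip of width 1. Two such edges are noncrossing if and only if their pairs are comparable in the
  product order, so the triangulations of the strip correspond to the maximal chains.\<close>

definition maximal_chain :: "nat \<Rightarrow> (nat \<times> nat) set \<Rightarrow> bool" where
  "maximal_chain n Z \<longleftrightarrow> Z \<subseteq> {..n} \<times> {..n} \<and>
     (\<forall>(j, k)\<in>Z. \<forall>(j', k')\<in>Z. (j \<le> j' \<and> k \<le> k') \<or> (j' \<le> j \<and> k' \<le> k)) \<and>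
     (\<forall>j\<le>n. \<forall>k\<le>n. (\<forall>(j', k')\<in>Z. (j \<le> j' \<and> k \<le> k') \<or> (j' \<le> j \<and> k' \<le> k)) \<longrightarrow> (j, k) \<in> Z)"

definition vertical_edge :: "nat \<times> nat \<Rightarrow> edge" where
  "vertical_edge = (\<lambda>(i, l). closed_segment (real i, real l) (real i, real (Suc l)))"

definition strip_edge :: "nat \<times> nat \<times> nat \<Rightarrow> edge" where
  "strip_edge = (\<lambda>(i, j, k). closed_segment (real i, real j) (real (Suc i), real k))"

definition strip_triangulation :: "nat \<Rightarrow> nat \<Rightarrow> (nat \<times> nat) set \<Rightarrow> edge set" where
  "strip_triangulation m n Z = vertical_edge ` ({..m} \<times> {..<n}) \<union> strip_edge ` ({..<m} \<times> Z)"

lemma mem_vertical_edge: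
  "p \<in> vertical_edge (i, l) \<longleftrightarrow> fst p = real i \<and> real l \<le> snd p \<and> snd p \<le> real (Suc l)"
proof
  assume "p \<in> vertical_edge (i, l)"
  then obtain u where u: "0 \<le> u" "u \<le> 1"
    "p = (1 - u) *\<^sub>R (real i, real l) + u *\<^sub>R (real i, real (Suc l))"
    unfolding vertical_edge_def prod.case in_segment by blast
  then show "fst p = real i \<and> real l \<le> snd p \<and> snd p \<le> real (Suc l)"
    by (simp add: algebra_simps)
next
  assume p: "fst p = real i \<and> real l \<le> snd p \<and> snd p \<le> real (Suc l)"
  then have "p = (1 - (snd p - real l)) *\<^sub>R (real i, real l) + (snd p - real l) *\<^sub>R (real i, real (Suc l))"
    by (intro prod_eqI) (simp_all add: algebra_simps)
  then show "p \<in> vertical_edge (i, l)"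
    using p unfolding vertical_edge_def in_segment prod.case
    by (intro exI [of _ "snd p - real l"]) auto
qed

lemma mem_strip_edge:
  "p \<in> strip_edge (i, j, k) \<longleftrightarrow>
     (\<exists>u. 0 \<le> u \<and> u \<le> 1 \<and> p = (real i + u, (1 - u) * real j + u * real k))"
  unfolding strip_edge_def in_segment prod.case by (simp add: algebra_simps)

lemma extreme_point_of_vertical_edge:
  "p extreme_point_of vertical_edge (i, l) \<longleftrightarrow> p = (real i, real l) \<or> p = (real i, real (Suc l))"
  by (simp add: vertical_edge_def extreme_point_of_segment)

lemma extreme_point_of_strip_edge:
  "p extreme_point_of strip_edge (i, j, k) \<longleftrightarrow> p = (real i, real j) \<or> p = (real (Suc i), real k)"
  by (simp add: strip_edge_def extreme_point_of_segment)

lemma lattice_vertical_edge: "lattice_edge (real i, real l) (real i, real (Suc l))"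
  by (rule lattice_edge_if_unimodular [of _ _ "(1, 0)"]) (auto simp: det2_def)

lemma lattice_strip_edge: "lattice_edge (real i, real j) (real (Suc i), real k)"
  by (rule lattice_edge_if_unimodular [of _ _ "(0, 1)"]) (auto simp: det2_def)

lemma lattice_points_nat_iff: "(real i, real j) \<in> lattice_points m n \<longleftrightarrow> i \<le> m \<and> j \<le> n"
  by (auto simp: lattice_points_def)

lemma strip_triangulation_edges:
  assumes "maximal_chain n Z"
  shows "strip_triangulation m n Z \<subseteq> edges m n"
  using assms lattice_vertical_edge lattice_strip_edge
  by (auto simp: strip_triangulation_def vertical_edge_def strip_edge_def closed_segment_in_edges_iff
      lattice_points_nat_iff maximal_chain_def simp del: of_nat_Suc)

lemma spanning_strip_triangulation:
  assumes "n \<ge> 1" "maximal_chain n Z"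
  shows "spanning m n (strip_triangulation m n Z)"
proof -
  have "lattice_points m n \<subseteq> \<Union>(strip_triangulation m n Z)"
  proof
    fix p assume "p \<in> lattice_points m n"
    then obtain i j where p: "p = (real i, real j)" "i \<le> m" "j \<le> n"
      by (auto simp: lattice_points_def)
    then have "p \<in> vertical_edge (i, if j = n then n - 1 else j)"
      using \<open>n \<ge> 1\<close> by (auto simp: mem_vertical_edge)
    moreover have "vertical_edge (i, if j = n then n - 1 else j) \<in> strip_triangulation m n Z"
      using p \<open>n \<ge> 1\<close> by (auto simp: strip_triangulation_def)
    ultimately show "p \<in> \<Union>(strip_triangulation m n Z)" by blast
  qed
  then show ?thesis
    using strip_triangulation_edges [OF assms(2)] by (simp add: spanning_def)
qed

lemma mem_strip_edge_integer:
  assumes "p \<in> strip_edge (i, j, k)" "fst p = real x"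
  shows "p extreme_point_of strip_edge (i, j, k) \<and> (p = (real i, real j) \<or> p = (real (Suc i), real k))"
proof -
  from assms(1) obtain u where u: "0 \<le> u" "u \<le> 1" "p = (real i + u, (1 - u) * real j + u * real k)"
    unfolding mem_strip_edge by blast
  have "u = real_of_int (int x - int i)" using assms(2) u by simp
  moreover from this u(1,2) have "int x - int i = 0 \<or> int x - int i = 1" by linarith
  ultimately have "u = 0 \<or> u = 1" by linarith
  then show ?thesis using u(3) by (auto simp: extreme_point_of_strip_edge)
qed

lemma mem_vertical_edge_integer:
  assumes "p \<in> vertical_edge (i, l)" "snd p = real y"
  shows "p extreme_point_of vertical_edge (i, l)"
proof -
  have "y = l \<or> y = Suc l"
    using assms by (auto simp: mem_vertical_edge)
  then show ?thesis using assms by (auto simp: mem_vertical_edge extreme_point_of_vertical_edge prod_eq_iff)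
qed

text \<open>Within one strip, the vertical distance of two comparable edges is
  \<open>(1 - u) (j - j') + u (k - k')\<close>, with both terms of the same sign. It vanishes only if both do,
  and then \<open>u\<close> is 0 or 1.\<close>

lemma strip_edges_not_crossing:
  assumes "(j \<le> j' \<and> k \<le> k') \<or> (j' \<le> j \<and> k' \<le> k)" "(i, j, k) \<noteq> (i', j', k')"
    and p: "p \<in> strip_edge (i, j, k)" "p \<in> strip_edge (i', j', k')"
  shows "\<exists>x. fst p = real x"
proof -
  obtain u where u: "0 \<le> u" "u \<le> 1" "p = (real i + u, (1 - u) * real j + u * real k)"
    using p(1) unfolding mem_strip_edge by blast
  obtain v where v: "0 \<le> v" "v \<le> 1" "p = (real i' + v, (1 - v) * real j' + v * real k')"
    using p(2) unfolding mem_strip_edge by blast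
  have iu: "real i + u = real i' + v" using u v by simp
  consider "i < i'" | "i' < i" | "i = i'" by linarith
  then show ?thesis
  proof cases
    case 1
    then have "u = 1" using iu u v by linarith
    then show ?thesis using u(3) by (intro exI [of _ "Suc i"]) simp
  next
    case 2
    then have "u = 0" using iu u v by linarith
    then show ?thesis using u(3) by (intro exI [of _ i]) simp
  next
    case 3
    then have "v = u" using iu by simp
    then have eq: "(1 - u) * (real j - real j') + u * (real k - real k') = 0"
      using u(3) v(3) by (simp add: algebra_simps)
    have "(1 - u) * (real j - real j') = 0 \<and> u * (real k - real k') = 0"
    proof (cases "j \<le> j' \<and> k \<le> k'")
      case True
      then have "(1 - u) * (real j - real j') \<le> 0" "u * (real k - real k') \<le> 0"
        using u by (auto intro: mult_nonneg_nonpos)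
      then show ?thesis using eq by linarith
    next
      case False
      then have "(1 - u) * (real j - real j') \<ge> 0" "u * (real k - real k') \<ge> 0"
        using assms(1) u by auto
      then show ?thesis using eq by linarith
    qed
    then have "u = 0 \<or> u = 1" using assms(2) 3 by auto
    then show ?thesis using u(3) by (auto intro: exI [of _ i] exI [of _ "Suc i"])
  qed
qed

text \<open>A common point of two distinct edges has an integral coordinate and lies on a lattice edge, so it
  is an endpoint of both.\<close>

lemma noncrossing_strip_triangulation:
  assumes Z: "maximal_chain n Z"
  shows "noncrossing_set m n (strip_triangulation m n Z)"
proof -
  have VV: "p extreme_point_of vertical_edge (i, l)"
    if "p \<in> vertical_edge (i, l)" "p \<in> vertical_edge (i', l')" "(i, l) \<noteq> (i', l')" for p i l i' l'
  proof -
    have "snd p = real l \<or> snd p = real (Suc l)"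
      using that by (cases l l' rule: linorder_cases) (auto simp: mem_vertical_edge)
    then show ?thesis using that mem_vertical_edge_integer by blast
  qed
  have VS: "p extreme_point_of vertical_edge (x, l) \<and> p extreme_point_of strip_edge (i, j, k)"
    if "p \<in> vertical_edge (x, l)" "p \<in> strip_edge (i, j, k)" for p x l i j k
    using that mem_strip_edge_integer [OF that(2)] mem_vertical_edge_integer [OF that(1)]
    by (metis mem_vertical_edge snd_conv)
  have SS: "p extreme_point_of strip_edge (i, j, k)"
    if "p \<in> strip_edge (i, j, k)" "p \<in> strip_edge (i', j', k')" "(i, j, k) \<noteq> (i', j', k')"
      "(j, k) \<in> Z" "(j', k') \<in> Z" for p i j k i' j' k'
  proof -
    have "(j \<le> j' \<and> k \<le> k') \<or> (j' \<le> j \<and> k' \<le> k)"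
      using Z that(4,5) unfolding maximal_chain_def by fast
    then show ?thesis
      using strip_edges_not_crossing that mem_strip_edge_integer by metis
  qed
  have "\<not> crosses e f"
    if "e \<in> strip_triangulation m n Z" "f \<in> strip_triangulation m n Z" "e \<noteq> f" for e f
  proof -
    have "p extreme_point_of e \<and> p extreme_point_of f" if p: "p \<in> e" "p \<in> f" for p
    proof -
      from \<open>e \<in> _\<close> consider (V) i l where "e = vertical_edge (i, l)"
        | (S) i j k where "e = strip_edge (i, j, k)" "(j, k) \<in> Z"
        unfolding strip_triangulation_def by auto
      then show ?thesis
      proof cases
        case e: V
        from \<open>f \<in> _\<close> consider (V) i l where "f = vertical_edge (i, l)"
          | (S) i j k where "f = strip_edge (i, j, k)" "(j, k) \<in> Z"
          unfolding strip_triangulation_def by auto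
        then show ?thesis using e VV VS p \<open>e \<noteq> f\<close> by cases metis+
      next
        case e: S
        from \<open>f \<in> _\<close> consider (V) i l where "f = vertical_edge (i, l)"
          | (S) i j k where "f = strip_edge (i, j, k)" "(j, k) \<in> Z"
          unfolding strip_triangulation_def by auto
        then show ?thesis using e SS VS p \<open>e \<noteq> f\<close> by cases metis+
      qed
    qed
    then show ?thesis unfolding crosses_def by blast
  qed
  then show ?thesis
    using strip_triangulation_edges [OF Z] unfolding noncrossing_set_def pairwise_def by blast
qed

text \<open>An edge of horizontal extent at least 2 crosses the vertical line next to its left end in its own
  relative interior, and that line is covered by vertical edges; for \<open>n = 0\<close> it would
  pass through a lattice point. An edge of extent 1 whose pair is
  incomparable to some pair in \<open>Z\<close> changes sides with the edge of that pair.\<close>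

lemma segment_to_strip_edge:
  assumes le: "fst a < fst b" and "closed_segment a b \<in> edges m n"
    and nc: "\<And>f. f \<in> strip_triangulation m n Z \<Longrightarrow> \<not> crosses (closed_segment a b) f"
    and Z: "maximal_chain n Z"
  shows "closed_segment a b \<in> strip_triangulation m n Z"
proof -
  have L: "a \<in> lattice_points m n" "b \<in> lattice_points m n"
    using assms(2) by (simp_all add: closed_segment_in_edges_iff)
  obtain i j where a: "a = (real i, real j)" "i \<le> m" "j \<le> n"
    using L by (auto simp: lattice_points_def)
  obtain i' k where b: "b = (real i', real k)" "i' \<le> m" "k \<le> n"
    using L by (auto simp: lattice_points_def)
  have ii': "i < i'" using le by (simp add: a b)
  have "\<not> Suc i < i'"
  proof
    assume long: "Suc i < i'"
    define u where "u = 1 / (real i' - real i)"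
    have u: "0 < u" "u < 1" "u * (real i' - real i) = 1"
      using long by (auto simp: u_def)
    then have u_step: "(1 - u) * real i + u * real i' = real i + 1"
      by (simp add: algebra_simps)
    define y where "y = (1 - u) * real j + u * real k"
    have p: "(real (Suc i), y) = (1 - u) *\<^sub>R a + u *\<^sub>R b"
      using u_step by (simp add: a b y_def)
    have mem: "(real (Suc i), y) \<in> closed_segment a b"
      unfolding in_segment using p u(1,2) by (intro exI [of _ u]) simp
    have "0 \<le> y" using u by (simp add: y_def)
    have "y \<le> (1 - u) * real n + u * real n"
      unfolding y_def using u a b by (intro add_mono mult_left_mono) auto
    then have "y \<le> real n" by (simp add: algebra_simps)
    have "n \<noteq> 0"
    proof
      assume "n = 0"
      have "lattice_edge a b" using assms(2) by (simp add: closed_segment_in_edges_iff)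
      moreover note mem
      moreover have "(real (Suc i), y) \<in> \<int> \<times> \<int>"
        using \<open>n = 0\<close> \<open>0 \<le> y\<close> \<open>y \<le> real n\<close> by simp
      ultimately have "(real (Suc i), y) \<in> {a, b}"
        unfolding lattice_edge_def by blast
      then show False using long by (auto simp: a b)
    qed
    \<comment> \<open>At the top, the topmost unit edge is the one below \<open>y\<close>.\<close>
    define l where "l = (if y = real n then n - 1 else nat \<lfloor>y\<rfloor>)"
    have l: "l < n" "real l \<le> y" "y \<le> real (Suc l)"
      using \<open>n \<noteq> 0\<close> \<open>0 \<le> y\<close> \<open>y \<le> real n\<close> unfolding l_def
      by (auto simp: nat_less_iff floor_less_iff of_nat_diff split: if_splits; linarith)+
    let ?f = "vertical_edge (Suc i, l)"
    have "(real (Suc i), y) \<in> closed_segment a b \<inter> ?f"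
      using mem l by (simp add: mem_vertical_edge)
    moreover have "\<not> (real (Suc i), y) extreme_point_of closed_segment a b"
      using long by (auto simp: extreme_point_of_segment a b)
    moreover have "a \<notin> ?f" by (simp add: a mem_vertical_edge)
    then have "closed_segment a b \<noteq> ?f" by (metis ends_in_segment(1))
    moreover have "?f \<in> strip_triangulation m n Z"
      using l(1) ii' b(2) by (auto simp: strip_triangulation_def)
    ultimately show False
      using nc unfolding crosses_def by blast
  qed
  with ii' have i': "i' = Suc i" by simp
  have e: "closed_segment a b = strip_edge (i, j, k)"
    by (simp add: strip_edge_def a b i')
  have "(j, k) \<in> Z"
  proof (rule ccontr)
    assume "(j, k) \<notin> Z"
    then have "\<not> (\<forall>(j', k')\<in>Z. (j \<le> j' \<and> k \<le> k') \<or> (j' \<le> j \<and> k' \<le> k))"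
      using Z a(3) b(3) unfolding maximal_chain_def by blast
    then obtain j' k' where Zjk': "(j', k') \<in> Z"
      and "\<not> ((j \<le> j' \<and> k \<le> k') \<or> (j' \<le> j \<and> k' \<le> k))"
      by auto
    then have inc: "(j < j' \<and> k' < k) \<or> (j' < j \<and> k < k')"
      by linarith
    \<comment> \<open>The abscissa, relative to \<open>i\<close>, where the two segments meet.\<close>
    define A B where "A = real j' - real j" and "B = real k - real k'"
    define u where "u = A / (A + B)"
    have AB: "(0 < A \<and> 0 < B) \<or> (A < 0 \<and> B < 0)"
      using inc by (auto simp: A_def B_def)
    then have "A + B \<noteq> 0" by auto
    have "0 < u" "u < 1"
      using AB by (auto simp: u_def divide_simps)
    moreover have "u * (A + B) = A"
      using \<open>A + B \<noteq> 0\<close> by (simp add: u_def)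
    then have "(1 - u) * A = u * B"
      by (simp add: algebra_simps)
    ultimately have u: "0 < u" "u < 1" "(1 - u) * (real j' - real j) = u * (real k - real k')"
      unfolding A_def B_def by blast+
    let ?p = "(real i + u, (1 - u) * real j + u * real k)"
    have "(1 - u) * real j + u * real k = (1 - u) * real j' + u * real k'"
      using u(3) by (simp add: algebra_simps)
    then have "?p \<in> strip_edge (i, j, k) \<inter> strip_edge (i, j', k')"
      using u(1,2) unfolding Int_iff mem_strip_edge by (auto intro!: exI [of _ u])
    moreover have "\<not> ?p extreme_point_of strip_edge (i, j, k)"
      using u(1,2) by (auto simp: extreme_point_of_strip_edge)
    moreover have "strip_edge (i, j, k) \<noteq> strip_edge (i, j', k')"
      using inc by (auto simp: strip_edge_def closed_segment_eq doubleton_eq_iff)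
    moreover have "strip_edge (i, j', k') \<in> strip_triangulation m n Z"
      using Zjk' b(2) i' by (auto simp: strip_triangulation_def)
    ultimately show False
      using nc e unfolding crosses_def by (metis (no_types, lifting))
  qed
  then show ?thesis
    unfolding e using b(2) i' by (auto simp: strip_triangulation_def)
qed

lemma strip_triangulation_in_triangulations:
  assumes Z: "maximal_chain n Z"
  shows "strip_triangulation m n Z \<in> triangulations m n"
proof -
  have "\<tau> = strip_triangulation m n Z"
    if \<tau>: "noncrossing_set m n \<tau>" "strip_triangulation m n Z \<subseteq> \<tau>" for \<tau>
  proof
    show "\<tau> \<subseteq> strip_triangulation m n Z"
    proof
      fix e assume "e \<in> \<tau>"
      then have "e \<in> edges m n" using \<tau>(1) by (auto simp: noncrossing_set_def)
      then obtain a b where e: "e = closed_segment a b" unfolding edges_def by blast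
      have nc: "\<not> crosses e f" if "f \<in> strip_triangulation m n Z" for f
        using \<tau> that \<open>e \<in> \<tau>\<close> unfolding noncrossing_set_def pairwise_def crosses_def by blast
      consider "fst a < fst b" | "fst b < fst a" | "fst a = fst b" by linarith
      then show "e \<in> strip_triangulation m n Z"
      proof cases
        case 1
        then show ?thesis using segment_to_strip_edge \<open>e \<in> edges m n\<close> nc Z unfolding e by blast
      next
        case 2
        then show ?thesis using segment_to_strip_edge \<open>e \<in> edges m n\<close> nc Z
          unfolding e closed_segment_commute [of a b] by blast
      next
        case 3
        have ab: "a \<in> lattice_points m n" "b \<in> lattice_points m n" "lattice_edge a b"
          using \<open>e \<in> edges m n\<close> by (simp_all add: e closed_segment_in_edges_iff)
        obtain i j where a: "a = (real i, real j)" "i \<le> m" "j \<le> n"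
          using ab(1) by (auto simp: lattice_points_def)
        obtain i' k where "b = (real i', real k)" "k \<le> n"
          using ab(2) by (auto simp: lattice_points_def)
        with 3 a have b: "b = (real i, real k)" "k \<le> n" by auto
        have "coprime (int i - int i) (int k - int j)"
          using ab(3) a b by (intro lattice_edge_coprime) simp
        then have "k = Suc j \<or> j = Suc k" by auto
        then have "e = vertical_edge (i, min j k)"
        proof
          assume "k = Suc j"
          then show ?thesis by (simp add: e a(1) b(1) vertical_edge_def)
        next
          assume "j = Suc k"
          then show ?thesis
            using closed_segment_commute [of a b] by (simp add: e a(1) b(1) vertical_edge_def)
        qed
        moreover have "min j k < n"
          using \<open>k = Suc j \<or> j = Suc k\<close> a(3) b(2) by auto
        ultimately show ?thesis using a(2) by (auto simp: strip_triangulation_def)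
      qed
    qed
  qed (rule \<tau>(2))
  then show ?thesis
    using noncrossing_strip_triangulation [OF Z] by (auto simp: triangulations_def)
qed

lemma slope_sum_strip_triangulation:
  assumes Z: "maximal_chain n Z"
  shows "slope_sum (strip_triangulation m n Z) = real m * (\<Sum>(j, k)\<in>Z. real k - real j)"
proof -
  have "finite Z" using Z finite_subset unfolding maximal_chain_def by blast
  have V: "odd_slope (vertical_edge il) = 0" for il
    by (auto simp: vertical_edge_def odd_slope_closed_segment split: prod.split)
  have S: "odd_slope (strip_edge (i, j, k)) = real k - real j" for i j k
    by (auto simp: strip_edge_def odd_slope_closed_segment intro: exI [of _ 0])
  have disj: "vertical_edge ` ({..m} \<times> {..<n}) \<inter> strip_edge ` ({..<m} \<times> Z) = {}"
    by (auto simp: vertical_edge_def strip_edge_def closed_segment_eq doubleton_eq_iff)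
  have inj: "inj_on strip_edge ({..<m} \<times> Z)"
    by (auto simp: inj_on_def strip_edge_def closed_segment_eq doubleton_eq_iff)
  have "slope_sum (strip_triangulation m n Z) =
      (\<Sum>e\<in>vertical_edge ` ({..m} \<times> {..<n}). odd_slope e) + (\<Sum>e\<in>strip_edge ` ({..<m} \<times> Z). odd_slope e)"
    unfolding slope_sum_def strip_triangulation_def
    using \<open>finite Z\<close> disj by (intro sum.union_disjoint) auto
  also have "(\<Sum>e\<in>vertical_edge ` ({..m} \<times> {..<n}). odd_slope e) = 0"
    using V by (intro sum.neutral) auto
  also have "(\<Sum>e\<in>strip_edge ` ({..<m} \<times> Z). odd_slope e) = (\<Sum>(i, j, k)\<in>{..<m} \<times> Z. real k - real j)"
    by (subst sum.reindex [OF inj]) (auto simp: S intro!: sum.cong)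
  also have "\<dots> = (\<Sum>i<m. \<Sum>(j, k)\<in>Z. real k - real j)"
    unfolding sum.cartesian_product by (intro sum.cong) auto
  finally show ?thesis by simp
qed

text \<open>Fans at the lower left and upper right corner of the strip; \<open>steep_down\<close> uses the other two
  corners.\<close>

definition steep_up :: "nat \<Rightarrow> (nat \<times> nat) set" where
  "steep_up n = {0} \<times> {..n} \<union> {1..n} \<times> {n}"

definition steep_down :: "nat \<Rightarrow> (nat \<times> nat) set" where
  "steep_down n = {..n} \<times> {0} \<union> {n} \<times> {1..n}"

lemma maximal_chain_steep_up: "maximal_chain n (steep_up n)"
  unfolding maximal_chain_def
proof (intro conjI allI impI)
  show "(j, k) \<in> steep_up n"
    if "j \<le> n" "k \<le> n" "\<forall>(j', k')\<in>steep_up n. j \<le> j' \<and> k \<le> k' \<or> j' \<le> j \<and> k' \<le> k" for j k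
    using that bspec [OF that(3), of "(0, n)"] by (auto simp: steep_up_def)
qed (auto simp: steep_up_def)

lemma maximal_chain_steep_down: "maximal_chain n (steep_down n)"
  unfolding maximal_chain_def
proof (intro conjI allI impI)
  show "(j, k) \<in> steep_down n"
    if "j \<le> n" "k \<le> n" "\<forall>(j', k')\<in>steep_down n. j \<le> j' \<and> k \<le> k' \<or> j' \<le> j \<and> k' \<le> k" for j k
    using that bspec [OF that(3), of "(n, 0)"] by (auto simp: steep_down_def)
qed (auto simp: steep_down_def)

text \<open>The fan at the lower left has slopes \<open>0, \<dots>, n\<close>, the one at the upper right \<open>n - 1, \<dots>, 0\<close>.
  Pairing \<open>k\<close> with \<open>n - k\<close> for \<open>k = 1, \<dots>, n\<close> gives \<open>n\<close> times \<open>n\<close>.\<close>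

lemma slope_steep_up: "(\<Sum>(j, k)\<in>steep_up n. real k - real j) = (real n)\<^sup>2"
proof -
  have "(\<Sum>(j, k)\<in>steep_up n. real k - real j) =
      (\<Sum>(j, k)\<in>{0} \<times> {..n}. real k - real j) + (\<Sum>(j, k)\<in>{1..n} \<times> {n}. real k - real j)"
    unfolding steep_up_def by (rule sum.union_disjoint) auto
  also have "\<dots> = (\<Sum>k\<le>n. real k) + (\<Sum>j=1..n. real n - real j)"
    by (simp flip: sum.cartesian_product)
  also have "(\<Sum>k\<le>n. real k) = (\<Sum>k=1..n. real k)"
    by (rule sum.mono_neutral_right) auto
  also have "\<dots> + (\<Sum>j=1..n. real n - real j) = (\<Sum>j=1..n. real n)"
    by (simp flip: sum.distrib)
  finally show ?thesis by (simp add: power2_eq_square)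
qed

lemma slope_steep_down: "(\<Sum>(j, k)\<in>steep_down n. real k - real j) = - (real n)\<^sup>2"
proof -
  have "steep_down n = prod.swap ` steep_up n"
    by (auto simp: steep_down_def steep_up_def)
  then have "(\<Sum>(j, k)\<in>steep_down n. real k - real j) = (\<Sum>(j, k)\<in>steep_up n. real j - real k)"
    by (simp add: sum.reindex case_prod_unfold)
  also have "\<dots> = - (\<Sum>(j, k)\<in>steep_up n. real k - real j)"
    by (simp add: case_prod_unfold flip: sum_negf)
  finally show ?thesis by (simp add: slope_steep_up)
qed

lemma slope_sum_gap:
  "slope_sum (strip_triangulation m n (steep_up n)) - slope_sum (strip_triangulation m n (steep_down n))
     = 2 * real m * (real n)\<^sup>2"
  by (simp add: slope_sum_strip_triangulation maximal_chain_steep_up maximal_chain_steep_down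
      slope_steep_up slope_steep_down)


section \<open>Transposition\<close>

abbreviation transpose_edge :: "edge \<Rightarrow> edge" where
  "transpose_edge \<equiv> (`) prod.swap"

abbreviation transpose :: "edge set \<Rightarrow> edge set" where
  "transpose \<equiv> (`) transpose_edge"

lemma linear_swap: "linear (prod.swap :: point \<Rightarrow> point)"
  by (rule linearI) (auto simp: prod.swap_def)

lemma transpose_transpose: "transpose (transpose \<sigma>) = \<sigma>"
  by (simp add: image_image)

lemma inj_transpose_edge: "inj transpose_edge"
  by (rule injI) (metis image_inv_f_f inj_swap inj_image_eq_iff)

lemma transpose_closed_segment:
  "transpose_edge (closed_segment a b) = closed_segment (prod.swap a) (prod.swap b)"
  by (rule closed_segment_linear_image [OF linear_swap, symmetric])

lemma swap_Ints: "prod.swap a \<in> \<int> \<times> \<int> \<longleftrightarrow> a \<in> \<int> \<times> (\<int> :: real set)"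
  by (cases a) auto

lemma swap_lattice_points: "prod.swap a \<in> lattice_points n m \<longleftrightarrow> a \<in> lattice_points m n"
  unfolding lattice_points_eq by (cases a) auto

lemma lattice_edge_swap:
  assumes "lattice_edge a b"
  shows "lattice_edge (prod.swap a) (prod.swap b)"
proof -
  have "closed_segment (prod.swap a) (prod.swap b) \<inter> (\<int> \<times> \<int>) =
      transpose_edge (closed_segment a b \<inter> (\<int> \<times> \<int>))"
    unfolding transpose_closed_segment [symmetric] by auto
  also have "\<dots> = {prod.swap a, prod.swap b}"
    using assms by (simp add: lattice_edge_def)
  finally show ?thesis
    using assms unfolding lattice_edge_def swap_Ints by (simp add: inj_eq [OF inj_swap])
qed

lemma transpose_edges:
  assumes "e \<in> edges m n"
  shows "transpose_edge e \<in> edges n m"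
proof -
  obtain a b where e: "e = closed_segment a b"
    using assms unfolding edges_def by blast
  show ?thesis
    using assms lattice_edge_swap
    unfolding e transpose_closed_segment closed_segment_in_edges_iff swap_lattice_points by simp
qed

lemma transpose_crosses:
  "crosses (transpose_edge e) (transpose_edge f) \<longleftrightarrow> crosses e f"
proof -
  have "transpose_edge e = transpose_edge f \<longleftrightarrow> e = f"
    using inj_transpose_edge by (simp add: inj_eq)
  moreover have "prod.swap p extreme_point_of transpose_edge g \<longleftrightarrow> p extreme_point_of g" for p and g :: edge
    using face_of_linear_image [OF linear_swap inj_swap, of "{p}" g] by (simp add: face_of_singleton)
  moreover have "transpose_edge e \<inter> transpose_edge f = transpose_edge (e \<inter> f)"
    by (rule image_Int [OF inj_swap, symmetric])
  ultimately show ?thesis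
    unfolding crosses_def by simp
qed

lemma transpose_noncrossing:
  assumes "noncrossing_set m n \<sigma>"
  shows "noncrossing_set n m (transpose \<sigma>)"
proof -
  have "transpose \<sigma> \<subseteq> edges n m"
    using assms transpose_edges unfolding noncrossing_set_def by blast
  moreover have "pairwise (\<lambda>e f. \<not> crosses e f) (transpose \<sigma>)"
    unfolding pairwise_image using assms
    by (auto simp only: noncrossing_set_def pairwise_def transpose_crosses)
  ultimately show ?thesis
    by (simp add: noncrossing_set_def)
qed

lemma transpose_in_triangulations:
  assumes "\<sigma> \<in> triangulations m n"
  shows "transpose \<sigma> \<in> triangulations n m"
proof -
  have "\<tau> = transpose \<sigma>" if "noncrossing_set n m \<tau>" "transpose \<sigma> \<subseteq> \<tau>" for \<tau>
  proof -
    have "transpose (transpose \<sigma>) \<subseteq> transpose \<tau>" using that(2) by (rule image_mono)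
    then have "transpose \<tau> = \<sigma>"
      using assms transpose_noncrossing [OF that(1)]
      unfolding triangulations_def transpose_transpose by blast
    then show ?thesis using transpose_transpose [of \<tau>] by simp
  qed
  then show ?thesis
    using assms transpose_noncrossing unfolding triangulations_def by blast
qed

lemma transpose_spanning:
  assumes "spanning m n \<sigma>"
  shows "spanning n m (transpose \<sigma>)"
proof -
  have "p \<in> \<Union>(transpose \<sigma>)" if p: "p \<in> lattice_points n m" for p
  proof -
    have "prod.swap p \<in> \<Union>\<sigma>"
      using assms p swap_lattice_points unfolding spanning_def by blast
    then obtain e where e: "e \<in> \<sigma>" "prod.swap p \<in> e" by blast
    then have "p \<in> transpose_edge e" by (auto simp: image_iff intro: bexI [of _ "prod.swap p"])
    then show ?thesis using e(1) by blast
  qed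
  then show ?thesis
    using assms transpose_edges unfolding spanning_def by blast
qed

text \<open>The data that \<open>odd_slope_parallelogram_diagonals\<close> needs of a flip are symmetric in the two
  coordinates. So the potential can be evaluated after transposition, and the dynamics
  itself need not be transposed.\<close>

lemma slope_sum_transpose_flip:
  assumes "spanning m n \<sigma>" "flips_to \<sigma> e e'"
  shows "\<bar>slope_sum (transpose (insert e' (\<sigma> - {e}))) - slope_sum (transpose \<sigma>)\<bar> \<le> 2"
proof -
  from assms obtain a b c d where abcd: "e = closed_segment a b" "e' = closed_segment c d"
    "lattice_edge a b" "lattice_edge c d" "\<bar>det2 (b - a) (d - c)\<bar> = 2" "c + d = a + b"
    "e \<in> \<sigma>" "e' \<notin> \<sigma>"
    by (rule flip_cases)
  have eq: "slope_sum (transpose \<tau>) = (\<Sum>f\<in>\<tau>. odd_slope (transpose_edge f))" for \<tau>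
    unfolding slope_sum_def
    by (subst sum.reindex) (auto intro: inj_on_subset [OF inj_transpose_edge])
  have "slope_sum (transpose (insert e' (\<sigma> - {e}))) - slope_sum (transpose \<sigma>) =
      odd_slope (transpose_edge e') - odd_slope (transpose_edge e)"
    unfolding eq using abcd(7,8) spanning_finite [OF assms(1)] by (simp add: sum_diff1)
  moreover have "prod.swap c + prod.swap d = prod.swap a + prod.swap b"
    unfolding linear_add [OF linear_swap, symmetric] abcd(6) ..
  moreover have "\<bar>det2 (prod.swap b - prod.swap a) (prod.swap d - prod.swap c)\<bar> = 2"
    using abcd(5) by (simp add: det2_def abs_minus_commute mult.commute)
  ultimately show ?thesis
    unfolding abcd(1,2) transpose_closed_segment
    using odd_slope_parallelogram_diagonals lattice_edge_swap abcd(3,4) by simp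
qed


section \<open>Mixing requires meeting\<close>

lemma glauber_step_cases:
  assumes "\<rho> \<in> set_pmf (glauber_step m n lam \<sigma>)"
  obtains "\<rho> = \<sigma>" | e e' where "flips_to \<sigma> e e'" "\<rho> = insert e' (\<sigma> - {e})"
proof -
  from assms obtain x where x: "\<rho> \<in> set_pmf (let e = edge_at \<sigma> x; e' = flipped \<sigma> e in
     if flippable \<sigma> e
     then map_pmf (\<lambda>flip. if flip then insert e' (\<sigma> - {e}) else \<sigma>)
       (bernoulli_pmf (lam powr edge_length e' / (lam powr edge_length e' + lam powr edge_length e)))
     else return_pmf \<sigma>)"
    unfolding glauber_step_def by (auto simp only: set_bind_pmf)
  define e where "e = edge_at \<sigma> x"
  show thesis
  proof (cases "\<rho> = \<sigma>")
    case False
    with x have "flippable \<sigma> e" "\<rho> = insert (flipped \<sigma> e) (\<sigma> - {e})"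
      by (auto simp: Let_def e_def split: if_splits)
    moreover from this have "flips_to \<sigma> e (flipped \<sigma> e)"
      unfolding flippable_def flipped_def by (metis someI_ex)
    ultimately show thesis using that by blast
  qed (rule that)
qed

text \<open>By \<open>flip_cases\<close> the dynamics stays among spanning sets, where the bound on \<open>\<Phi>\<close> applies to each
  step.\<close>

lemma glauber_law_drift:
  assumes "spanning m n \<sigma>" "\<rho> \<in> set_pmf (glauber_law m n lam t \<sigma>)"
    and \<Phi>: "\<And>\<sigma> e e'. spanning m n \<sigma> \<Longrightarrow> flips_to \<sigma> e e' \<Longrightarrow>
           \<bar>\<Phi> (insert e' (\<sigma> - {e})) - \<Phi> \<sigma>\<bar> \<le> (2 :: real)"
  shows "spanning m n \<rho> \<and> \<bar>\<Phi> \<rho> - \<Phi> \<sigma>\<bar> \<le> 2 * real t"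
  using assms(2)
proof (induction t arbitrary: \<rho>)
  case 0
  then show ?case using assms(1) by (simp add: glauber_law_def)
next
  case (Suc t)
  then obtain \<rho>' where \<rho>': "\<rho>' \<in> set_pmf (glauber_law m n lam t \<sigma>)"
    and step: "\<rho> \<in> set_pmf (glauber_step m n lam \<rho>')"
    by (auto simp: glauber_law_def)
  note IH = Suc.IH [OF \<rho>']
  from step show ?case
  proof (cases rule: glauber_step_cases)
    case 1
    then show ?thesis using IH by auto
  next
    case (2 e e')
    then have "spanning m n \<rho>"
      using IH flip_cases by metis
    moreover have "\<bar>\<Phi> \<rho> - \<Phi> \<rho>'\<bar> \<le> 2"
      using 2 IH \<Phi> by simp
    ultimately show ?thesis using IH by auto
  qed
qed

lemma prob_diff_le_tv_dist:
  "\<bar>measure_pmf.prob p A - measure_pmf.prob q A\<bar> \<le> tv_dist p q"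
  unfolding tv_dist_def
proof (rule cSUP_upper)
  have "\<bar>measure_pmf.prob p A - measure_pmf.prob q A\<bar> \<le> 1" for A
    using measure_pmf.prob_le_1 [of p A] measure_pmf.prob_le_1 [of q A]
      measure_nonneg [of p A] measure_nonneg [of q A] by linarith
  then show "bdd_above (range (\<lambda>A. \<bar>measure_pmf.prob p A - measure_pmf.prob q A\<bar>))"
    by (intro bdd_aboveI2)
qed simp

text \<open>Otherwise the support of \<open>p\<close> has probability 1 under \<open>p\<close> and 0 under \<open>q\<close>, while each of the two
  differs from its probability under \<open>r\<close> by at most \<open>1/4\<close>.\<close>

lemma tv_dist_common_support:
  assumes "tv_dist p r \<le> 1 / 4" "tv_dist q r \<le> 1 / 4"
  shows "set_pmf p \<inter> set_pmf q \<noteq> {}"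
proof
  assume disj: "set_pmf p \<inter> set_pmf q = {}"
  have "measure_pmf.prob p (set_pmf p) = 1"
    by (rule measure_pmf.prob_eq_1 [THEN iffD2]) (auto simp: AE_measure_pmf)
  moreover have "measure_pmf.prob q (set_pmf p) = 0"
    using disj by (simp add: measure_pmf_zero_iff Int_commute)
  ultimately show False
    using prob_diff_le_tv_dist [of p "set_pmf p" r] prob_diff_le_tv_dist [of q "set_pmf p" r] assms
    by linarith
qed

text \<open>At the mixing time \<open>t\<close>, some \<open>\<rho>\<close> is reachable from both \<open>\<sigma>\<close> and \<open>\<tau>\<close> in \<open>t\<close> steps, so the
  potentials of \<open>\<sigma>\<close> and \<open>\<tau>\<close> differ by at most \<open>2 t + 2 t\<close>. If the chain never mixes, the mixing
  time is infinite.\<close>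

lemma mixing_time_ge:
  assumes "\<sigma> \<in> triangulations m n" "\<tau> \<in> triangulations m n" "spanning m n \<sigma>" "spanning m n \<tau>"
    and \<Phi>: "\<And>\<sigma> e e'. spanning m n \<sigma> \<Longrightarrow> flips_to \<sigma> e e' \<Longrightarrow>
           \<bar>\<Phi> (insert e' (\<sigma> - {e})) - \<Phi> \<sigma>\<bar> \<le> (2 :: real)"
  shows "ereal ((\<Phi> \<sigma> - \<Phi> \<tau>) / 4) \<le> ereal_of_enat (mixing_time m n lam)"
proof -
  define T where "T = {enat t | t.
     (MAX \<sigma> \<in> triangulations m n. tv_dist (glauber_law m n lam t \<sigma>) (gibbs m n lam)) \<le> 1 / 4}"
  show ?thesis
  proof (cases "T = {}")
    case True
    then have "mixing_time m n lam = \<infinity>"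
      unfolding mixing_time_def T_def [symmetric] by (simp add: Inf_enat_def)
    then show ?thesis by simp
  next
    case False
    then have "mixing_time m n lam \<in> T"
      unfolding mixing_time_def T_def [symmetric] by (auto simp: Inf_enat_def intro: LeastI)
    then obtain t where t: "mixing_time m n lam = enat t"
      and max: "(MAX \<sigma> \<in> triangulations m n. tv_dist (glauber_law m n lam t \<sigma>) (gibbs m n lam)) \<le> 1 / 4"
      unfolding T_def by blast
    have tv: "tv_dist (glauber_law m n lam t \<rho>) (gibbs m n lam) \<le> 1 / 4"
      if "\<rho> \<in> triangulations m n" for \<rho>
    proof -
      have "tv_dist (glauber_law m n lam t \<rho>) (gibbs m n lam) \<le>
          (MAX \<sigma> \<in> triangulations m n. tv_dist (glauber_law m n lam t \<sigma>) (gibbs m n lam))"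
        using that finite_triangulations by (intro Max_ge) auto
      then show ?thesis using max by linarith
    qed
    obtain \<rho> where "\<rho> \<in> set_pmf (glauber_law m n lam t \<sigma>)" "\<rho> \<in> set_pmf (glauber_law m n lam t \<tau>)"
      using tv_dist_common_support [OF tv [OF assms(1)] tv [OF assms(2)]] by blast
    then have "\<bar>\<Phi> \<rho> - \<Phi> \<sigma>\<bar> \<le> 2 * real t" "\<bar>\<Phi> \<rho> - \<Phi> \<tau>\<bar> \<le> 2 * real t"
      using glauber_law_drift [OF assms(3)] glauber_law_drift [OF assms(4)] \<Phi> by blast+
    then have "\<Phi> \<sigma> - \<Phi> \<tau> \<le> 4 * real t" by linarith
    then show ?thesis by (simp add: t)
  qed
qed

theorem proposition6p3:
  "\<exists>c::real. c > 0 \<and>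
     (\<forall>(m::nat) (n::nat) (lam::real). m \<ge> 1 \<longrightarrow> n \<ge> 1 \<longrightarrow> lam > 0 \<longrightarrow>
        ereal_of_enat (mixing_time m n lam) \<ge> ereal (c * real m * real n * (real m + real n)))"
proof (intro exI [of _ "1/4"] conjI allI impI)
  fix m n :: nat and lam :: real
  assume "m \<ge> 1" "n \<ge> 1"
  note chains = maximal_chain_steep_up maximal_chain_steep_down
  have vert: "ereal (2 * real m * (real n)\<^sup>2 / 4) \<le> ereal_of_enat (mixing_time m n lam)"
    unfolding slope_sum_gap [symmetric]
    by (intro mixing_time_ge slope_sum_flip strip_triangulation_in_triangulations
        spanning_strip_triangulation chains \<open>n \<ge> 1\<close>)
  have "ereal ((slope_sum (transpose (transpose (strip_triangulation n m (steep_up m)))) -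
      slope_sum (transpose (transpose (strip_triangulation n m (steep_down m))))) / 4)
      \<le> ereal_of_enat (mixing_time m n lam)"
    by (intro mixing_time_ge slope_sum_transpose_flip transpose_in_triangulations transpose_spanning
        strip_triangulation_in_triangulations spanning_strip_triangulation chains \<open>m \<ge> 1\<close>)
  then have hor: "ereal (2 * real n * (real m)\<^sup>2 / 4) \<le> ereal_of_enat (mixing_time m n lam)"
    unfolding transpose_transpose slope_sum_gap .
  have "1 / 4 * real m * real n * (real m + real n) =
      (2 * real m * (real n)\<^sup>2 / 4 + 2 * real n * (real m)\<^sup>2 / 4) / 2"
    by (simp add: power2_eq_square algebra_simps)
  also have "\<dots> \<le> max (2 * real m * (real n)\<^sup>2 / 4) (2 * real n * (real m)\<^sup>2 / 4)"
    by (simp add: max_def)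
  finally have "ereal (1 / 4 * real m * real n * (real m + real n)) \<le>
      max (ereal (2 * real m * (real n)\<^sup>2 / 4)) (ereal (2 * real n * (real m)\<^sup>2 / 4))"
    by (simp only: ereal_less_eq(3) flip: ereal_max)
  then show "ereal (1 / 4 * real m * real n * (real m + real n)) \<le> ereal_of_enat (mixing_time m n lam)"
    by (rule order_trans) (rule max.boundedI [OF vert hor])
qed simp

end
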